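(* Let $p$ be an odd prime, let $\sigma\subset\mathbb{C}_p$ be compact, let $f:\mathbb{Z}_p\to\sigma$ be continuous, and let $\nu_f^E\in\mathbf{L}^*(\sigma)$ be the fermionic spectral distribution associated with $f$. There exists a nonempty open set $\Omega\subset\mathbb{C}_p$ such that for every $\lambda\in\Omega$ and every $s\in\mathbb{Z}_p$ the integral $$\zeta_{p,E}^{\nu_f^E}(s,\lambda)=\int_\sigma\langle\lambda+x\rangle^{1-s}\,d\nu_f^E(x)$$ is well-defined. Moreover, $\zeta_{p,E}^{\nu_f^E}(s,\lambda)$ is $C^\infty$ in $s$ on $\mathbb{Z}_p$ (for each $\lambda\in\Omega$) and locally analytic in $\lambda$ on $\Omega$ (for each $s\in\mathbb{Z}_p$).
   Context: Notation. $\mathbb{C}_p$ is the completion of an algebraic closure of $\mathbb{Q}_p$, $|p|_p=p^{-1}$, $v_p$ is the additive valuation with $v_p(p)=1$. Fix a compatible system of fractional powers $p^r\in\mathbb{C}_p$, $r\in\mathbb{Q}$ (with $p^{r+r'}=p^rp^{r'}$ and $p^1=p$). For $a\in\mathbb{C}_p^\times$ write $a=p^{v_p(a)}u$ with $|u|_p=1$, let $\hat a=\lim_{n\to\infty}u^{p^{n!}}$ (the root of unity of order prime to $p$ with $|\hat a-u|_p<1$), and put $\omega_v(a)=p^{v_p(a)}\hat a$ and $\langle a\rangle=a/\omega_v(a)$, so $|\langle a\rangle-1|_p<1$. For $s\in\mathbb{Z}_p$, $\langle a\rangle^s=\sum_{n\ge0}\binom{s}{n}(\langle a\rangle-1)^n$.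 Locally analytic functions and generalized distributions. For compact $\sigma\subset\mathbb{C}_p$ and $r>0$ let $D_a(r)=\{z\in\mathbb{C}_p:|z-a|_p<r\}$ and $\mathbb{D}_\sigma(r)=\bigcup_{a\in\sigma}D_a(r)$. $B_r(\sigma)$ is the Banach space of functions $f$ on $\mathbb{D}_\sigma(r)$ given by a convergent power series on each $D_a(r)$, $a\in\sigma$, with finite norm $\|f\|_r=\sup_{z\in\mathbb{D}_\sigma(r)}|f(z)|_p$. $\mathbf{L}(\sigma)$, the space of locally analytic functions on $\sigma$, is the union (inductive limit over $r\to0$, functions being identified if they agree on some $\mathbb{D}_\sigma(r')$) of the $B_r(\sigma)$, with the inductive limit topology. $\mathbf{L}^*(\sigma)$ is the space of continuous $\mathbb{C}_p$-linear maps $\mathbf{L}(\sigma)\to\mathbb{C}_p$ (generalized distributions); one writes $\int_\sigma f\,d\nu=\nu(f)$. Stieltjes transform. Put $\Omega_\sigma=\mathbb{C}_p\setminus\sigma$ and $\Omega_\sigma(r)=\{z\in\mathbb{C}_p:\mathrm{dist}(z,\sigma)\ge r\}$. A function $F:\Omega_\sigma\to\mathbb{C}_p$ is Krasner analytic if for every $r>0$ its restriction to $\Omega_\sigma(r)$ is a uniform limit of rational functions with all poles in $\sigma$; $H_0(\Omega_\sigma)$ is the space of Krasner analytic functions on $\Omega_\sigma$ tending to $0$ as $|z|_p\to\infty$. The Stieltjes transform of $\nu\in\mathbf{L}^*(\sigma)$ is $S_\nu(z)=\nu\bigl(x\mapsto\frac{1}{z-x}\bigr)$, $z\in\Omega_\sigma$.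 By Vishik's theorem $S:\mathbf{L}^*(\sigma)\to H_0(\Omega_\sigma)$ is a bijection. Fermionic spectral distribution. The bounded measure $\mu_{-1}$ on $\mathbb{Z}_p$ is given by $\mu_{-1}(a+p^N\mathbb{Z}_p)=(-1)^a$ for $0\le a<p^N$, so $\int_{\mathbb{Z}_p}g\,d\mu_{-1}=\lim_{N\to\infty}\sum_{a=0}^{p^N-1}g(a)(-1)^a$ for continuous $g$. The fermionic resolvent of $f$ is $F_f^E(z)=\int_{\mathbb{Z}_p}\frac{d\mu_{-1}(a)}{z-f(a)}$, $z\in\Omega_\sigma$; it lies in $H_0(\Omega_\sigma)$, and $\nu_f^E\in\mathbf{L}^*(\sigma)$ is the unique element with $S_{\nu_f^E}=F_f^E$. A function on $\mathbb{Z}_p$ is $C^n$ if its $n$-th iterated difference quotient extends continuously to $\mathbb{Z}_p^{n+1}$, and $C^\infty$ if it is $C^n$ for all $n$. A function on an open subset of $\mathbb{C}_p$ is locally analytic if near each point it is given by a convergent power series. *)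

theory Defs
  imports
    "HOL-Analysis.Analysis"
    "HOL-Computational_Algebra.Polynomial"
    "HOL-Computational_Algebra.Primes"
begin

section \<open>The field of complex p-adic numbers\<close>

text \<open>
  There is no type depending on \<open>p\<close>, so the field of complex \<open>p\<close>-adic numbers is an arbitrary type
  satisfying the predicate \<open>is_Cp\<close> below. The metric is the one of the type class, and the
  absolute value is the distance to \<open>0\<close>; completeness comes from the class \<open>complete_space\<close>.
\<close>

definition vabs :: "'a::{zero, metric_space} \<Rightarrow> real" where
  "vabs x = dist x 0"

text \<open>Inside a complete valued field, \<open>\<int>\<^sub>p\<close> and \<open>\<rat>\<^sub>p\<close> are the completions, that is the closures,
  of \<open>\<int>\<close> and \<open>\<rat>\<close>.\<close>

definition Zp :: "'a::{field_char_0, metric_space} set" where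
  "Zp = closure \<int>"

definition Qp :: "'a::{field_char_0, metric_space} set" where
  "Qp = closure \<rat>"

definition Qp_alg :: "'a::{field_char_0, metric_space} set" where
  "Qp_alg = {x. \<exists>q. q \<noteq> 0 \<and> (\<forall>i. coeff q i \<in> Qp) \<and> poly q x = 0}"

text \<open>The first four conditions say that the metric comes from a non-archimedean absolute value
  with \<open>|p| = 1/p\<close>, which forces it to restrict to the usual \<open>p\<close>-adic absolute value on \<open>\<rat>\<close>. The
  last two say that \<open>Qp_alg\<close> is an algebraic closure of \<open>\<rat>\<^sub>p\<close> and that the whole (complete) field is
  its completion.\<close>

definition is_Cp :: "'a::{field_char_0, complete_space} itself \<Rightarrow> nat \<Rightarrow> bool" where
  "is_Cp _ p \<longleftrightarrow>
     (\<forall>x y :: 'a. dist x y = vabs (x - y)) \<and>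
     (\<forall>x y :: 'a. vabs (x * y) = vabs x * vabs y) \<and>
     (\<forall>x y :: 'a. vabs (x + y) \<le> max (vabs x) (vabs y)) \<and>
     vabs (of_nat p :: 'a) = 1 / real p \<and>
     (\<forall>q :: 'a poly. degree q > 0 \<and> (\<forall>i. coeff q i \<in> Qp_alg) \<longrightarrow> (\<exists>x\<in>Qp_alg. poly q x = 0)) \<and>
     closure (Qp_alg :: 'a set) = UNIV"

section \<open>The projection \<open>\<langle>a\<rangle>\<close> and its powers\<close>

definition fractional_powers :: "nat \<Rightarrow> (rat \<Rightarrow> 'a::field_char_0) \<Rightarrow> bool" where
  "fractional_powers p P \<longleftrightarrow> (\<forall>r r'. P (r + r') = P r * P r') \<and> P 1 = of_nat p"

text \<open>The value group of \<open>\<complex>\<^sub>p\<close> is \<open>p\<close> to the power \<open>\<rat>\<close>, so the description below determines a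
  rational number for every \<open>a \<noteq> 0\<close>.\<close>

definition vp :: "nat \<Rightarrow> 'a::{zero, metric_space} \<Rightarrow> rat" where
  "vp p a = (THE r. vabs a = real p powr (- of_rat r))"

definition hat :: "nat \<Rightarrow> (rat \<Rightarrow> 'a) \<Rightarrow> 'a::{field_char_0, metric_space} \<Rightarrow> 'a" where
  "hat p P a = lim (\<lambda>n. (a / P (vp p a)) ^ (p ^ fact n))"

definition omega_v :: "nat \<Rightarrow> (rat \<Rightarrow> 'a) \<Rightarrow> 'a::{field_char_0, metric_space} \<Rightarrow> 'a" where
  "omega_v p P a = P (vp p a) * hat p P a"

definition angle :: "nat \<Rightarrow> (rat \<Rightarrow> 'a) \<Rightarrow> 'a::{field_char_0, metric_space} \<Rightarrow> 'a" where
  "angle p P a = a / omega_v p P a"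

definition angle_pow ::
  "nat \<Rightarrow> (rat \<Rightarrow> 'a) \<Rightarrow> 'a::{field_char_0, metric_space} \<Rightarrow> 'a \<Rightarrow> 'a" where
  "angle_pow p P a s = (\<Sum>n. (s gchoose n) * (angle p P a - 1) ^ n)"

section \<open>Locally analytic functions and generalized distributions\<close>

definition disc_nbhd :: "'a::metric_space set \<Rightarrow> real \<Rightarrow> 'a set" where
  "disc_nbhd \<sigma> r = (\<Union>a\<in>\<sigma>. ball a r)"

text \<open>Functions on \<open>disc_nbhd \<sigma> r\<close> are represented by total functions whose values elsewhere are
  arbitrary.\<close>

definition B_space :: "'a::{field_char_0, metric_space} set \<Rightarrow> real \<Rightarrow> ('a \<Rightarrow> 'a) set" where
  "B_space \<sigma> r = {g.
     (\<forall>a\<in>\<sigma>. \<exists>c. \<forall>z\<in>ball a r. (\<lambda>n. c n * (z - a) ^ n) sums g z) \<and>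
     bdd_above ((\<lambda>z. vabs (g z)) ` disc_nbhd \<sigma> r)}"

definition B_norm :: "'a::{field_char_0, metric_space} set \<Rightarrow> real \<Rightarrow> ('a \<Rightarrow> 'a) \<Rightarrow> real" where
  "B_norm \<sigma> r g = (SUP z\<in>disc_nbhd \<sigma> r. vabs (g z))"

text \<open>The space \<open>\<^bold>L(\<sigma>)\<close> is \<open>loc_an \<sigma>\<close> modulo \<open>germ_eq \<sigma>\<close>; we work with representatives.\<close>

definition loc_an :: "'a::{field_char_0, metric_space} set \<Rightarrow> ('a \<Rightarrow> 'a) set" where
  "loc_an \<sigma> = (\<Union>r\<in>{0<..}. B_space \<sigma> r)"

definition germ_eq :: "'a::metric_space set \<Rightarrow> ('a \<Rightarrow> 'a) \<Rightarrow> ('a \<Rightarrow> 'a) \<Rightarrow> bool" where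
  "germ_eq \<sigma> g h \<longleftrightarrow> (\<exists>r>0. \<forall>z\<in>disc_nbhd \<sigma> r. g z = h z)"

text \<open>Basic neighbourhoods of \<open>0\<close> in the (locally convex) inductive limit topology: absolutely
  convex sets, i.e. modules over the valuation ring, that meet every \<open>B_space \<sigma> r\<close> in a
  neighbourhood of \<open>0\<close>. Since a function vanishing near \<open>\<sigma>\<close> has norm \<open>0\<close> in some \<open>B_space \<sigma> r\<close>,
  all open sets are saturated with respect to \<open>germ_eq \<sigma>\<close>.\<close>

definition zero_nbhd :: "'a::{field_char_0, metric_space} set \<Rightarrow> ('a \<Rightarrow> 'a) set \<Rightarrow> bool" where
  "zero_nbhd \<sigma> V \<longleftrightarrow>
     V \<subseteq> loc_an \<sigma> \<and>
     (\<forall>g\<in>V. \<forall>h\<in>V. \<forall>a b. vabs a \<le> 1 \<and> vabs b \<le> 1 \<longrightarrow> (\<lambda>x. a * g x + b * h x) \<in> V) \<and>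
     (\<forall>r>0. \<exists>\<epsilon>>0. \<forall>g\<in>B_space \<sigma> r. B_norm \<sigma> r g < \<epsilon> \<longrightarrow> g \<in> V)"

definition loc_an_open :: "'a::{field_char_0, metric_space} set \<Rightarrow> ('a \<Rightarrow> 'a) set \<Rightarrow> bool" where
  "loc_an_open \<sigma> U \<longleftrightarrow>
     U \<subseteq> loc_an \<sigma> \<and>
     (\<forall>g\<in>U. \<exists>V. zero_nbhd \<sigma> V \<and> (\<forall>h\<in>V. (\<lambda>x. g x + h x) \<in> U))"

definition loc_an_topology :: "'a::{field_char_0, metric_space} set \<Rightarrow> ('a \<Rightarrow> 'a) topology" where
  "loc_an_topology \<sigma> = topology (loc_an_open \<sigma>)"

lemma zero_nbhd_Int:
  assumes V: "zero_nbhd \<sigma> V" and W: "zero_nbhd \<sigma> W"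
  shows "zero_nbhd \<sigma> (V \<inter> W)"
proof -
  have "\<exists>\<epsilon>>0. \<forall>g\<in>B_space \<sigma> r. B_norm \<sigma> r g < \<epsilon> \<longrightarrow> g \<in> V \<inter> W" if r: "r > 0" for r
  proof -
    from V r obtain d where d: "d > 0" "\<And>g. g \<in> B_space \<sigma> r \<Longrightarrow> B_norm \<sigma> r g < d \<Longrightarrow> g \<in> V"
      unfolding zero_nbhd_def by metis
    from W r obtain e where e: "e > 0" "\<And>g. g \<in> B_space \<sigma> r \<Longrightarrow> B_norm \<sigma> r g < e \<Longrightarrow> g \<in> W"
      unfolding zero_nbhd_def by metis
    show ?thesis
      by (rule exI[of _ "min d e"]) (use d e in simp)
  qed
  moreover have "V \<inter> W \<subseteq> loc_an \<sigma>"
    using V unfolding zero_nbhd_def by (meson inf.coboundedI1)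
  moreover have "(\<lambda>x. a * g x + b * h x) \<in> V \<inter> W"
    if "g \<in> V \<inter> W" "h \<in> V \<inter> W" "vabs a \<le> 1" "vabs b \<le> 1" for g h a b
    using V W that unfolding zero_nbhd_def by simp
  ultimately show ?thesis
    unfolding zero_nbhd_def by simp
qed

lemma istopology_loc_an_open: "istopology (loc_an_open \<sigma>)"
  unfolding istopology_def
proof (intro conjI allI impI)
  fix S T assume S: "loc_an_open \<sigma> S" and T: "loc_an_open \<sigma> T"
  have "\<exists>V. zero_nbhd \<sigma> V \<and> (\<forall>h\<in>V. (\<lambda>x. g x + h x) \<in> S \<inter> T)" if g: "g \<in> S" "g \<in> T" for g
  proof -
    from S g obtain V where V: "zero_nbhd \<sigma> V" "\<And>h. h \<in> V \<Longrightarrow> (\<lambda>x. g x + h x) \<in> S"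
      unfolding loc_an_open_def by metis
    from T g obtain W where W: "zero_nbhd \<sigma> W" "\<And>h. h \<in> W \<Longrightarrow> (\<lambda>x. g x + h x) \<in> T"
      unfolding loc_an_open_def by metis
    show ?thesis
      by (rule exI[of _ "V \<inter> W"]) (use V W zero_nbhd_Int in simp)
  qed
  moreover have "S \<inter> T \<subseteq> loc_an \<sigma>"
    using S unfolding loc_an_open_def by (meson inf.coboundedI1)
  ultimately show "loc_an_open \<sigma> (S \<inter> T)"
    unfolding loc_an_open_def by simp
next
  fix K assume K: "\<forall>S\<in>K. loc_an_open \<sigma> S"
  have "\<exists>V. zero_nbhd \<sigma> V \<and> (\<forall>h\<in>V. (\<lambda>x. g x + h x) \<in> \<Union>K)" if "S \<in> K" "g \<in> S" for S g
  proof -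
    from K that obtain V where V: "zero_nbhd \<sigma> V" "\<And>h. h \<in> V \<Longrightarrow> (\<lambda>x. g x + h x) \<in> S"
      unfolding loc_an_open_def by metis
    show ?thesis
      by (rule exI[of _ V]) (use V that in auto)
  qed
  moreover have "\<Union>K \<subseteq> loc_an \<sigma>"
    using K unfolding loc_an_open_def by (meson Sup_least)
  ultimately show "loc_an_open \<sigma> (\<Union>K)"
    unfolding loc_an_open_def by (meson UnionE)
qed

lemma openin_loc_an_topology: "openin (loc_an_topology \<sigma>) = loc_an_open \<sigma>"
  unfolding loc_an_topology_def by (rule topology_inverse'[OF istopology_loc_an_open])

text \<open>Generalized distributions; the values of \<open>\<nu>\<close> outside \<open>loc_an \<sigma>\<close> carry no information.\<close>

definition gen_dist ::
  "'a::{field_char_0, metric_space} set \<Rightarrow> (('a \<Rightarrow> 'a) \<Rightarrow> 'a) set" where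
  "gen_dist \<sigma> = {\<nu>.
     (\<forall>g\<in>loc_an \<sigma>. \<forall>h\<in>loc_an \<sigma>. germ_eq \<sigma> g h \<longrightarrow> \<nu> g = \<nu> h) \<and>
     (\<forall>g\<in>loc_an \<sigma>. \<forall>h\<in>loc_an \<sigma>. \<nu> (\<lambda>x. g x + h x) = \<nu> g + \<nu> h) \<and>
     (\<forall>c. \<forall>g\<in>loc_an \<sigma>. \<nu> (\<lambda>x. c * g x) = c * \<nu> g) \<and>
     continuous_map (loc_an_topology \<sigma>) euclidean \<nu>}"

definition Stieltjes :: "(('a \<Rightarrow> 'a) \<Rightarrow> 'a) \<Rightarrow> 'a::field \<Rightarrow> 'a" where
  "Stieltjes \<nu> z = \<nu> (\<lambda>x. 1 / (z - x))"

section \<open>The fermionic spectral distribution\<close>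

text \<open>The limit of the Riemann sums of \<open>g\<close> for the measure giving \<open>a + p\<^sup>N \<int>\<^sub>p\<close>
  the mass \<open>(-1)\<^sup>a\<close>, for \<open>0 \<le> a < p\<^sup>N\<close>.\<close>

definition fermionic_integral :: "nat \<Rightarrow> ('a \<Rightarrow> 'a) \<Rightarrow> 'a::{field_char_0, metric_space}" where
  "fermionic_integral p g = lim (\<lambda>N. \<Sum>a<p ^ N. g (of_nat a) * (-1) ^ a)"

definition fermionic_resolvent ::
  "nat \<Rightarrow> ('a \<Rightarrow> 'a) \<Rightarrow> 'a::{field_char_0, metric_space} \<Rightarrow> 'a" where
  "fermionic_resolvent p f z = fermionic_integral p (\<lambda>a. 1 / (z - f a))"

text \<open>By Vishik's theorem there is exactly one such \<open>\<nu>\<close>, as an element of the dual of \<open>\<^bold>L(\<sigma>)\<close>.\<close>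

definition fermionic_spectral_distribution ::
  "nat \<Rightarrow> 'a::{field_char_0, metric_space} set \<Rightarrow> ('a \<Rightarrow> 'a) \<Rightarrow> (('a \<Rightarrow> 'a) \<Rightarrow> 'a) \<Rightarrow> bool" where
  "fermionic_spectral_distribution p \<sigma> f \<nu> \<longleftrightarrow>
     \<nu> \<in> gen_dist \<sigma> \<and> (\<forall>z\<in>- \<sigma>. Stieltjes \<nu> z = fermionic_resolvent p f z)"

section \<open>The zeta function\<close>

definition zeta_integrand ::
  "nat \<Rightarrow> (rat \<Rightarrow> 'a) \<Rightarrow> 'a::{field_char_0, metric_space} \<Rightarrow> 'a \<Rightarrow> 'a \<Rightarrow> 'a" where
  "zeta_integrand p P s l = (\<lambda>x. angle_pow p P (l + x) (1 - s))"

text \<open>\<open>\<langle>l + x\<rangle>\<close> only makes sense for \<open>l + x \<noteq> 0\<close>, so this has to be required on the discs on which the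
  integrand is to be analytic.\<close>

definition zeta_well_defined ::
  "nat \<Rightarrow> (rat \<Rightarrow> 'a) \<Rightarrow> 'a::{field_char_0, metric_space} set \<Rightarrow> 'a \<Rightarrow> 'a \<Rightarrow> bool" where
  "zeta_well_defined p P \<sigma> s l \<longleftrightarrow>
     (\<exists>r>0. (\<forall>x\<in>disc_nbhd \<sigma> r. l + x \<noteq> 0) \<and> zeta_integrand p P s l \<in> B_space \<sigma> r)"

definition zeta_E ::
  "nat \<Rightarrow> (rat \<Rightarrow> 'a) \<Rightarrow> (('a \<Rightarrow> 'a) \<Rightarrow> 'a) \<Rightarrow> 'a::{field_char_0, metric_space} \<Rightarrow> 'a \<Rightarrow> 'a" where
  "zeta_E p P \<nu> s l = \<nu> (zeta_integrand p P s l)"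

section \<open>Regularity\<close>

text \<open>Iterated difference quotients, with the \<open>n\<close>-th one evaluated at lists of \<open>n + 1\<close> distinct
  points.\<close>

fun diff_quot :: "('a::field \<Rightarrow> 'a) \<Rightarrow> 'a list \<Rightarrow> 'a" where
  "diff_quot g [] = 0"
| "diff_quot g [x] = g x"
| "diff_quot g (x # y # zs) = (diff_quot g (x # zs) - diff_quot g (y # zs)) / (x - y)"

definition C_n_Zp :: "nat \<Rightarrow> ('a::{field_char_0, metric_space} \<Rightarrow> 'a) \<Rightarrow> bool" where
  "C_n_Zp n g \<longleftrightarrow>
     (\<exists>G. continuous_map (product_topology (\<lambda>_. top_of_set Zp) {..n}) euclidean G \<and>
          (\<forall>x \<in> {..n} \<rightarrow>\<^sub>E Zp. inj_on x {..n} \<longrightarrow> G x = diff_quot g (map x [0..<Suc n])))"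

definition C_infinity_Zp :: "('a::{field_char_0, metric_space} \<Rightarrow> 'a) \<Rightarrow> bool" where
  "C_infinity_Zp g \<longleftrightarrow> (\<forall>n. C_n_Zp n g)"

definition locally_analytic_on ::
  "'a::{field_char_0, metric_space} set \<Rightarrow> ('a \<Rightarrow> 'a) \<Rightarrow> bool" where
  "locally_analytic_on \<Omega> h \<longleftrightarrow>
     (\<forall>a\<in>\<Omega>. \<exists>r>0. \<exists>c. ball a r \<subseteq> \<Omega> \<and> (\<forall>z\<in>ball a r. (\<lambda>n. c n * (z - a) ^ n) sums h z))"

end

theory Submission
  imports Defs
begin

text \<open>
  For large \<open>N\<close> the set \<open>\<Omega> = {l. \<bar>p\<^sup>N l - 1\<bar> \<le> p\<^sup>-\<^sup>3}\<close> lies so far from the origin that \<open>\<sigma>\<close> is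
  negligible in comparison: for \<open>l \<in> \<Omega>\<close> and \<open>x\<close> near \<open>\<sigma>\<close> one has \<open>\<langle>l + x\<rangle> = p\<^sup>N (l + x) = 1 + w\<close> with
  \<open>\<bar>w\<bar> \<le> p\<^sup>-\<^sup>3\<close>. Continuity of \<open>\<nu>\<close> gives \<open>\<bar>\<nu>(w\<^sup>n)\<bar> \<le> C p\<^sup>-\<^sup>3\<^sup>n\<close>, and the zeta function is the sum of the
  \<open>((1 - s) gchoose n) \<nu>(w\<^sup>n)\<close>. As \<open>\<bar>1/n!\<bar> \<le> p\<^sup>n\<close>, this series may be differenced in \<open>s\<close> term by term, and
  re-expanded around any point in \<open>l\<close>.
\<close>

section \<open>Complete non-archimedean fields\<close>

text \<open>The argument \<open>T\<close> lets the locale be interpreted at \<open>TYPE('a)\<close>.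
  Completeness enters through the class \<open>complete_space\<close>; the metric is tied to the
  field operations only by these assumptions.\<close>

locale padic_field =
  fixes T :: "'a::{field_char_0, complete_space} itself" and p :: nat
  assumes dist_vabs: "\<And>x y :: 'a. dist x y = vabs (x - y)"
    and vabs_mult: "\<And>x y :: 'a. vabs (x * y) = vabs x * vabs y"
    and vabs_add_le_max: "\<And>x y :: 'a. vabs (x + y) \<le> max (vabs x) (vabs y)"
    and vabs_p: "vabs (of_nat p :: 'a) = 1 / real p"
    and prime_p: "prime p"
begin

abbreviation \<theta> :: real where "\<theta> \<equiv> 1 / real p"

lemma p_gt_1: "real p > 1"
  using prime_gt_1_nat[OF prime_p] by simp

lemma theta_gt_0: "0 < \<theta>" and theta_lt_1: "\<theta> < 1"
  using p_gt_1 by simp_all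

lemma theta_power_le_1: "\<theta> ^ n \<le> 1"
  using theta_gt_0 theta_lt_1 by (intro power_le_one) auto

section \<open>Arithmetic of the ultrametric absolute value\<close>

lemma vabs_nonneg [simp]: "0 \<le> vabs (x::'a)"
  by (simp add: vabs_def)

lemma vabs_eq_0_iff [simp]: "vabs (x::'a) = 0 \<longleftrightarrow> x = 0"
  by (simp add: vabs_def)

lemma vabs_zero [simp]: "vabs (0::'a) = 0"
  by simp

lemma vabs_one [simp]: "vabs (1::'a) = 1"
  using vabs_mult[of 1 1] vabs_eq_0_iff[of 1] by (metis mult_cancel_left1 mult_1 zero_neq_one)

lemma vabs_minus [simp]: "vabs (- x::'a) = vabs x"
  using dist_vabs[of 0 x] dist_vabs[of x 0] by (simp add: dist_commute)

lemma vabs_power: "vabs (x ^ n :: 'a) = vabs x ^ n"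
  by (induction n) (simp_all add: vabs_mult)

lemma vabs_inverse: "vabs (inverse x :: 'a) = inverse (vabs x)"
proof (cases "x = 0")
  case False
  then have "vabs x * vabs (inverse x) = 1"
    by (simp flip: vabs_mult)
  then show ?thesis
    by (metis inverse_unique)
qed simp

lemma vabs_divide: "vabs (x / y :: 'a) = vabs x / vabs y"
  by (simp add: divide_inverse vabs_mult vabs_inverse)

lemma vabs_prod: "vabs (\<Prod>i\<in>A. f i :: 'a) = (\<Prod>i\<in>A. vabs (f i))"
  by (induction A rule: infinite_finite_induct) (simp_all add: vabs_mult)

lemma vabs_add_le: "vabs x \<le> c \<Longrightarrow> vabs y \<le> c \<Longrightarrow> vabs (x + y :: 'a) \<le> c"
  using vabs_add_le_max[of x y] by simp

lemma vabs_diff_le: "vabs x \<le> c \<Longrightarrow> vabs y \<le> c \<Longrightarrow> vabs (x - y :: 'a) \<le> c"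
  using vabs_add_le[of x c "- y"] by simp

lemma vabs_sum_le:
  assumes "0 \<le> c" "\<And>i. i \<in> A \<Longrightarrow> vabs (f i :: 'a) \<le> c"
  shows "vabs (sum f A) \<le> c"
  using assms(2)
  by (induction A rule: infinite_finite_induct) (auto simp: assms(1) intro!: vabs_add_le)

lemma vabs_mult_le: "vabs x \<le> a \<Longrightarrow> vabs y \<le> b \<Longrightarrow> vabs (x * y :: 'a) \<le> a * b"
  by (metis vabs_mult vabs_nonneg mult_mono order_trans)

lemma vabs_mult_le_right: "vabs x \<le> 1 \<Longrightarrow> vabs y \<le> b \<Longrightarrow> vabs (x * y :: 'a) \<le> b"
  using vabs_mult_le[of x 1 y b] by simp

section \<open>Integers and factorials\<close>

lemma vabs_of_nat_le_1: "vabs (of_nat n :: 'a) \<le> 1"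
  by (induction n) (simp_all add: vabs_add_le)

lemma vabs_of_int_le_1: "vabs (of_int n :: 'a) \<le> 1"
proof (cases n rule: int_cases2)
  case (nonneg m)
  then show ?thesis using vabs_of_nat_le_1[of m] by simp
next
  case (nonpos m)
  then show ?thesis using vabs_of_nat_le_1[of m] by simp
qed

text \<open>By Bezout, 1 is a combination of \<open>n\<close> and \<open>p\<close> with integer
  coefficients. If the absolute value of \<open>n\<close> were below 1, that of 1 would be below 1
  as well.\<close>

lemma vabs_of_nat_coprime:
  assumes "\<not> p dvd n"
  shows "vabs (of_nat n :: 'a) = 1"
proof (rule ccontr)
  assume neq: "vabs (of_nat n :: 'a) \<noteq> 1"
  have "coprime (int n) (int p)"
    using prime_imp_coprime[OF prime_p assms] by (simp add: coprime_commute)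
  then obtain a b where ab: "a * int n + b * int p = 1"
    by (metis bezout_int coprime_imp_gcd_eq_1)
  define c where "c = max (vabs (of_nat n :: 'a)) \<theta>"
  have "(1::'a) = of_int (a * int n + b * int p)"
    by (simp only: ab of_int_1)
  then have "(1::'a) = of_int a * of_nat n + of_int b * of_nat p"
    by simp
  moreover have "vabs (of_int a * of_nat n + of_int b * of_nat p :: 'a) \<le> c"
    using vabs_mult_le_right[OF vabs_of_int_le_1, of "of_nat n" c a]
      vabs_mult_le_right[OF vabs_of_int_le_1, of "of_nat p" c b]
    by (intro vabs_add_le) (auto simp: c_def vabs_p)
  moreover have "c < 1"
    using neq vabs_of_nat_le_1[of n] theta_lt_1 by (simp add: c_def)
  ultimately show False
    by (metis linorder_not_le vabs_one)
qed

text \<open>A crude Legendre formula. Only the multiples of \<open>p\<close> among the factors of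
  the factorial count, and pulling \<open>p\<close> out of them leaves
  \<open>\<theta> ^ m * vabs (fact m)\<close> with \<open>m = n div p\<close>. As
  \<open>2 * m \<le> n\<close>, induction loses at most \<open>\<theta> ^ n\<close>.\<close>

lemma vabs_fact_ge: "\<theta> ^ n \<le> vabs (fact n :: 'a)"
proof (induction n rule: less_induct)
  case (less n)
  show ?case
  proof (cases "n = 0")
    case False
    define m where "m = n div p"
    define A where "A = {i \<in> {1..n}. p dvd i}"
    have p2: "p \<ge> 2"
      by (rule prime_ge_2_nat[OF prime_p])
    have A: "A = (*) p ` {1..m}"
    proof (intro set_eqI iffI)
      fix i assume "i \<in> A"
      then obtain j where "i = p * j" "1 \<le> i" "i \<le> n"
        by (auto simp: A_def)
      then show "i \<in> (*) p ` {1..m}"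
        using p2 by (auto simp: m_def less_eq_div_iff_mult_less_eq mult.commute intro!: imageI)
    next
      fix i assume "i \<in> (*) p ` {1..m}"
      then show "i \<in> A"
        using p2 by (auto simp: A_def m_def less_eq_div_iff_mult_less_eq mult.commute)
    qed
    have "m < n"
      using False p2 by (simp add: m_def)
    have "m + m \<le> n"
    proof -
      have "m * 2 \<le> m * p"
        using p2 by simp
      also have "\<dots> \<le> n"
        by (simp add: m_def)
      finally show ?thesis by simp
    qed
    have "vabs (fact n :: 'a) = (\<Prod>i\<in>{1..n}. vabs (of_nat i :: 'a))"
      by (simp add: fact_prod vabs_prod)
    also have "\<dots> = (\<Prod>i\<in>A. vabs (of_nat i :: 'a)) * (\<Prod>i\<in>{1..n} - A. vabs (of_nat i :: 'a))"
      by (subst mult.commute, rule prod.subset_diff) (auto simp: A_def)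
    also have "(\<Prod>i\<in>{1..n} - A. vabs (of_nat i :: 'a)) = 1"
      by (rule prod.neutral) (auto simp: A_def vabs_of_nat_coprime)
    also have "(\<Prod>i\<in>A. vabs (of_nat i :: 'a)) = (\<Prod>j\<in>{1..m}. vabs (of_nat (p * j) :: 'a))"
      unfolding A using p2 by (subst prod.reindex) (auto simp: inj_on_def)
    also have "\<dots> = \<theta> ^ m * vabs (fact m :: 'a)"
      by (simp add: vabs_mult vabs_p prod_dividef fact_prod vabs_prod power_divide)
    finally have eq: "vabs (fact n :: 'a) = \<theta> ^ m * vabs (fact m :: 'a)"
      by simp
    have "\<theta> ^ n \<le> \<theta> ^ (m + m)"
      using theta_gt_0 theta_lt_1 \<open>m + m \<le> n\<close> by (intro power_decreasing) auto
    also have "\<dots> \<le> \<theta> ^ m * vabs (fact m :: 'a)"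
      unfolding power_add using less.IH[OF \<open>m < n\<close>] by (intro mult_left_mono) auto
    finally show ?thesis
      by (simp add: eq)
  qed simp
qed

text \<open>\<open>\<int>\<close> is dense in \<open>Zp\<close>, and an integer at distance below 1
  from \<open>s\<close> passes its bound on by the ultrametric inequality.\<close>

lemma vabs_le_1_if_Zp: "s \<in> Zp \<Longrightarrow> vabs (s::'a) \<le> 1"
proof -
  assume "s \<in> Zp"
  then obtain x where x: "x \<in> \<int>" "dist x s < 1"
    unfolding Zp_def closure_approachable by (meson zero_less_one)
  then obtain n where "x = of_int n"
    by (auto simp: Ints_def)
  then have "vabs x \<le> 1" "vabs (x - s) \<le> 1"
    using vabs_of_int_le_1 x(2) by (simp_all add: dist_vabs)
  then show ?thesis
    using vabs_diff_le[of x 1 "x - s"] by simp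
qed

section \<open>Limits and series\<close>

lemma LIMSEQ_vabs: "X \<longlonglongrightarrow> (L::'a) \<longleftrightarrow> (\<forall>e>0. \<exists>N. \<forall>n\<ge>N. vabs (X n - L) < e)"
  by (simp add: LIMSEQ_def dist_vabs)

lemma vabs_limit_le:
  assumes "X \<longlonglongrightarrow> (L::'a)" "\<And>n. n \<ge> K \<Longrightarrow> vabs (X n - y) \<le> c"
  shows "vabs (L - y) \<le> c"
proof -
  have "(\<lambda>n. dist (X n) y) \<longlonglongrightarrow> dist L y"
    using assms(1) by (intro tendsto_intros)
  then show ?thesis
    using assms(2) LIMSEQ_le_const2[of _ "dist L y" c] by (auto simp: dist_vabs)
qed

lemma LIMSEQ_geometric_bound:
  assumes "\<And>n. vabs (X n - (L::'a)) \<le> C * q ^ n" "0 \<le> q" "q < 1"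
  shows "X \<longlonglongrightarrow> L"
proof -
  have "(\<lambda>n. C * q ^ n) \<longlonglongrightarrow> 0"
    using assms(2,3) by (intro tendsto_mult_right_zero LIMSEQ_realpow_zero)
  then have "(\<lambda>n. dist (X n) L) \<longlonglongrightarrow> 0"
    by (rule tendsto_sandwich[OF _ _ tendsto_const, rotated 2])
      (use assms(1) in \<open>auto simp: dist_vabs\<close>)
  then show ?thesis
    by (rule tendsto_dist_iff[THEN iffD2])
qed

lemma sums_vabs_le:
  assumes "f sums (S::'a)" "\<And>n. vabs (f n) \<le> c"
  shows "vabs S \<le> c"
proof -
  have "0 \<le> c"
    using assms(2)[of 0] vabs_nonneg[of "f 0"] by linarith
  then show ?thesis
    using vabs_limit_le[of "\<lambda>n. sum f {..<n}" S 0 0 c] assms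
    by (simp add: sums_def vabs_sum_le)
qed

text \<open>A block of terms is no larger than the bound for its first term, so the partial sums are
  Cauchy. The same estimate survives in the limit, which gives the tail bound without the usual
  factor \<open>1 / (1 - q)\<close>.\<close>

lemma nonarch_summable:
  assumes bound: "\<And>n. vabs (f n :: 'a) \<le> C * q ^ n" and q: "0 \<le> q" "q < 1"
  obtains S where "f sums S" "\<And>K. vabs (S - sum f {..<K}) \<le> C * q ^ K"
proof -
  have C: "0 \<le> C"
    using bound[of 0] vabs_nonneg[of "f 0"] by (simp del: vabs_nonneg)
  have tail: "vabs (sum f {..<n} - sum f {..<K}) \<le> C * q ^ K" if "n \<ge> K" for n K
  proof -
    have "sum f {..<n} - sum f {..<K} = sum f {K..<n}"
      using sum_diff_nat_ivl[of 0 K n f] that by (simp add: atLeast0LessThan)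
    also have "vabs \<dots> \<le> C * q ^ K"
    proof (rule vabs_sum_le)
      fix i assume "i \<in> {K..<n}"
      then have "C * q ^ i \<le> C * q ^ K"
        using C q by (intro mult_left_mono power_decreasing) auto
      then show "vabs (f i) \<le> C * q ^ K"
        using bound[of i] by linarith
    qed (use C q in auto)
    finally show ?thesis .
  qed
  have "Cauchy (\<lambda>n. sum f {..<n})"
  proof (rule CauchyI')
    fix e :: real assume "e > 0"
    have "(\<lambda>n. C * q ^ n) \<longlonglongrightarrow> 0"
      using q by (intro tendsto_mult_right_zero LIMSEQ_realpow_zero)
    then have "eventually (\<lambda>n. C * q ^ n < e) sequentially"
      using \<open>e > 0\<close> by (rule order_tendstoD)
    then obtain K where K: "C * q ^ n < e" if "n \<ge> K" for n
      by (auto simp: eventually_sequentially)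
    have "dist (sum f {..<m}) (sum f {..<n}) < e" if "m \<ge> K" "n > m" for m n
      using tail[of m n] K[of m] that dist_commute[of "sum f {..<m}" "sum f {..<n}"]
      by (simp add: dist_vabs)
    then show "\<exists>M. \<forall>m\<ge>M. \<forall>n>m. dist (sum f {..<m}) (sum f {..<n}) < e"
      by auto
  qed
  then obtain S where S: "(\<lambda>n. sum f {..<n}) \<longlonglongrightarrow> S"
    using convergent_eq_Cauchy by blast
  show ?thesis
  proof
    show "f sums S"
      using S by (simp add: sums_def)
    show "vabs (S - sum f {..<K}) \<le> C * q ^ K" for K
      using vabs_limit_le[OF S, of K] tail by simp
  qed
qed

text \<open>The type class provides a metric without compatibility with the field operations. For
  series this is recovered from the properties of \<open>vabs\<close>, here and in the next two
  lemmas.\<close>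

lemma nonarch_sums_add:
  assumes "f sums (S::'a)" "g sums S'"
  shows "(\<lambda>n. f n + g n) sums (S + S')"
  unfolding sums_def LIMSEQ_vabs
proof (intro allI impI)
  fix e :: real assume "e > 0"
  then obtain N N' where N: "\<And>n. n \<ge> N \<Longrightarrow> vabs (sum f {..<n} - S) < e"
    and N': "\<And>n. n \<ge> N' \<Longrightarrow> vabs (sum g {..<n} - S') < e"
    using assms unfolding sums_def LIMSEQ_vabs by metis
  have "vabs (sum (\<lambda>n. f n + g n) {..<n} - (S + S')) < e" if "n \<ge> max N N'" for n
  proof -
    have "sum (\<lambda>n. f n + g n) {..<n} - (S + S') = (sum f {..<n} - S) + (sum g {..<n} - S')"
      by (simp add: sum.distrib)
    then show ?thesis
      using vabs_add_le_max[of "sum f {..<n} - S" "sum g {..<n} - S'"] N[of n] N'[of n] that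
      by (simp only:) auto
  qed
  then show "\<exists>N. \<forall>n\<ge>N. vabs (sum (\<lambda>n. f n + g n) {..<n} - (S + S')) < e"
    by blast
qed

lemma nonarch_sums_mult:
  assumes "f sums (S::'a)"
  shows "(\<lambda>n. c * f n) sums (c * S)"
  unfolding sums_def LIMSEQ_vabs
proof (intro allI impI)
  fix e :: real assume "e > 0"
  define d where "d = e / (vabs c + 1)"
  have c: "vabs c + 1 > 0"
    using vabs_nonneg[of c] by linarith
  then have "d > 0"
    using \<open>e > 0\<close> by (simp add: d_def)
  then obtain N where N: "vabs (sum f {..<n} - S) < d" if "n \<ge> N" for n
    using assms unfolding sums_def LIMSEQ_vabs by metis
  have "vabs (sum (\<lambda>n. c * f n) {..<n} - c * S) < e" if "n \<ge> N" for n
  proof -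
    have "vabs (sum (\<lambda>n. c * f n) {..<n} - c * S) = vabs c * vabs (sum f {..<n} - S)"
      by (simp add: sum_distrib_left right_diff_distrib flip: vabs_mult)
    also have "\<dots> \<le> vabs c * d"
      using N[OF that] by (intro mult_left_mono) auto
    also have "\<dots> < (vabs c + 1) * d"
      using \<open>d > 0\<close> by simp
    also have "\<dots> = e"
      using c by (simp add: d_def)
    finally show ?thesis .
  qed
  then show "\<exists>N. \<forall>n\<ge>N. vabs (sum (\<lambda>n. c * f n) {..<n} - c * S) < e"
    by blast
qed

lemma nonarch_sums_diff:
  assumes "f sums (S::'a)" "g sums S'"
  shows "(\<lambda>n. f n - g n) sums (S - S')"
  using nonarch_sums_add[OF assms(1) nonarch_sums_mult[OF assms(2), of "- 1"]] by simp

text \<open>Truncating both orders of summation at \<open>N\<close>, the partial sums differ by a remainder of size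
  \<open>(\<beta> \<rho>)\<^sup>N\<close>.\<close>

lemma sums_binomial_rearrange:
  fixes b m :: "nat \<Rightarrow> 'a"
  assumes \<rho>: "0 < \<rho>" and \<beta>: "0 \<le> \<beta>" "\<beta> * \<rho> < 1"
    and b: "\<And>n. vabs (b n) \<le> B * \<beta> ^ n" and m: "\<And>n. vabs (m n) \<le> C * \<rho> ^ n"
  obtains c where
    "\<And>t S. vabs t \<le> \<rho> \<Longrightarrow> (\<lambda>n. b n * (\<Sum>k\<le>n. of_nat (n choose k) * m (n - k) * t ^ k)) sums S
        \<Longrightarrow> (\<lambda>k. c k * t ^ k) sums S"
proof -
  \<comment> \<open>\<open>e n k\<close> is the coefficient of \<open>t ^ k\<close> in the
    \<open>n\<close>-th term. The value 0 for \<open>k > n\<close> lets all inner sums run to a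
    common bound later.\<close>
  define e where "e n k = (if k \<le> n then b n * (of_nat (n choose k) * m (n - k)) else 0)" for n k
  have nn: "0 \<le> B" "0 \<le> C"
    using b[of 0] m[of 0] vabs_nonneg[of "b 0"] vabs_nonneg[of "m 0"] by (simp_all del: vabs_nonneg)
  have q: "0 \<le> \<beta> * \<rho>"
    using \<rho> \<beta> by simp
  \<comment> \<open>With weight \<open>\<rho> ^ k\<close> the powers \<open>\<rho> ^ (n - k)\<close>
    and \<open>\<rho> ^ k\<close> merge, so the bound depends on \<open>n\<close> alone.\<close>
  have e_le: "vabs (e n k) * \<rho> ^ k \<le> B * C * (\<beta> * \<rho>) ^ n" for n k
  proof (cases "k \<le> n")
    case True
    have "vabs (e n k) \<le> (B * \<beta> ^ n) * (C * \<rho> ^ (n - k))"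
      using True vabs_mult_le[OF b vabs_mult_le_right[OF vabs_of_nat_le_1 m]]
      by (simp add: e_def)
    then have "vabs (e n k) * \<rho> ^ k \<le> (B * \<beta> ^ n) * (C * \<rho> ^ (n - k)) * \<rho> ^ k"
      using \<rho> by (intro mult_right_mono) auto
    also have "\<dots> = B * C * \<beta> ^ n * (\<rho> ^ (n - k) * \<rho> ^ k)"
      by (simp add: mult_ac)
    also have "\<rho> ^ (n - k) * \<rho> ^ k = \<rho> ^ n"
      using True by (simp flip: power_add)
    finally show ?thesis
      by (simp add: power_mult_distrib mult_ac)
  qed (use nn q in \<open>simp add: e_def\<close>)
  \<comment> \<open>The \<open>k\<close>-th new coefficient is the sum of column \<open>k\<close>.
    It is fixed before \<open>t\<close> is, as a power series requires, and its tail estimate is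
    kept for the truncation below.\<close>
  have "\<exists>s. (\<lambda>n. e n k) sums s \<and> (\<forall>K. vabs (s - sum (\<lambda>n. e n k) {..<K}) \<le> B * C / \<rho> ^ k * (\<beta> * \<rho>) ^ K)"
    for k
  proof -
    have "vabs (e n k) \<le> B * C / \<rho> ^ k * (\<beta> * \<rho>) ^ n" for n
      using e_le[of n k] \<rho> by (simp add: pos_le_divide_eq)
    from nonarch_summable[OF this q \<beta>(2)] show ?thesis
      by metis
  qed
  then obtain c where c: "vabs (c k - sum (\<lambda>n. e n k) {..<K}) \<le> B * C / \<rho> ^ k * (\<beta> * \<rho>) ^ K" for k K
    by metis
  have "(\<lambda>k. c k * t ^ k) sums S"
    if t: "vabs t \<le> \<rho>" and S: "(\<lambda>n. b n * (\<Sum>k\<le>n. of_nat (n choose k) * m (n - k) * t ^ k)) sums S"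
    for t S
  proof -
    define g where "g n = b n * (\<Sum>k\<le>n. of_nat (n choose k) * m (n - k) * t ^ k)" for n
    have diff: "vabs (sum (\<lambda>k. c k * t ^ k) {..<N} - sum g {..<N}) \<le> B * C * (\<beta> * \<rho>) ^ N" for N
    proof -
      have "g n = (\<Sum>k<N. e n k * t ^ k)" if "n < N" for n
      proof -
        have "g n = (\<Sum>k\<le>n. e n k * t ^ k)"
          by (simp add: g_def e_def sum_distrib_left mult_ac)
        also have "\<dots> = (\<Sum>k<N. e n k * t ^ k)"
          by (rule sum.mono_neutral_left) (use that in \<open>auto simp: e_def\<close>)
        finally show ?thesis .
      qed
      then have "sum g {..<N} = (\<Sum>n<N. \<Sum>k<N. e n k * t ^ k)"
        by simp
      also have "\<dots> = (\<Sum>k<N. (\<Sum>n<N. e n k) * t ^ k)"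
        by (subst sum.swap) (simp add: sum_distrib_right)
      finally have "sum (\<lambda>k. c k * t ^ k) {..<N} - sum g {..<N}
          = (\<Sum>k<N. (c k - (\<Sum>n<N. e n k)) * t ^ k)"
        by (simp add: left_diff_distrib sum_subtractf)
      also have "vabs \<dots> \<le> B * C * (\<beta> * \<rho>) ^ N"
      proof (rule vabs_sum_le)
        fix k
        have "vabs ((c k - (\<Sum>n<N. e n k)) * t ^ k) \<le> B * C / \<rho> ^ k * (\<beta> * \<rho>) ^ N * \<rho> ^ k"
          using c[of k N] t by (intro vabs_mult_le) (auto simp: vabs_power power_mono)
        then show "vabs ((c k - (\<Sum>n<N. e n k)) * t ^ k) \<le> B * C * (\<beta> * \<rho>) ^ N"
          using \<rho> by simp
      qed (use nn q in simp)
      finally show ?thesis .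
    qed
    have "(\<lambda>N. sum (\<lambda>k. c k * t ^ k) {..<N} - sum g {..<N}) \<longlonglongrightarrow> 0"
      by (rule LIMSEQ_geometric_bound[OF _ q \<beta>(2), of _ _ "B * C"]) (simp add: diff)
    then have "(\<lambda>k. c k * t ^ k - g k) sums 0"
      by (simp add: sums_def sum_subtractf)
    from nonarch_sums_add[OF this S[folded g_def]] show ?thesis
      by simp
  qed
  then show ?thesis
    using that by blast
qed

section \<open>Locally analytic functions\<close>

lemma B_space_antimono:
  assumes "g \<in> B_space \<sigma> r" "r' \<le> r"
  shows "(g :: 'a \<Rightarrow> 'a) \<in> B_space \<sigma> r'"
proof -
  have balls: "ball a r' \<subseteq> ball a r" for a :: 'a
    using assms(2) by auto
  then have "disc_nbhd \<sigma> r' \<subseteq> disc_nbhd \<sigma> r"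
    unfolding disc_nbhd_def by blast
  then have "bdd_above ((\<lambda>z. vabs (g z)) ` disc_nbhd \<sigma> r')"
    using assms(1) bdd_above_mono[OF _ image_mono] unfolding B_space_def mem_Collect_eq by metis
  moreover have "\<exists>c. \<forall>z\<in>ball a r'. (\<lambda>n. c n * (z - a) ^ n) sums g z" if "a \<in> \<sigma>" for a
  proof -
    from assms(1) that obtain c where "\<forall>z\<in>ball a r. (\<lambda>n. c n * (z - a) ^ n) sums g z"
      unfolding B_space_def by blast
    then show ?thesis
      using balls by blast
  qed
  ultimately show ?thesis
    unfolding B_space_def by simp
qed

lemma B_space_lincomb:
  fixes g h :: "'a \<Rightarrow> 'a"
  assumes g: "g \<in> B_space \<sigma> r" and h: "h \<in> B_space \<sigma> r"
  shows "(\<lambda>x. a * g x + b * h x) \<in> B_space \<sigma> r"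
proof -
  have "\<exists>c. \<forall>z\<in>ball x r. (\<lambda>n. c n * (z - x) ^ n) sums (a * g z + b * h z)" if x: "x \<in> \<sigma>" for x
  proof -
    from g x obtain c where c: "\<And>z. z \<in> ball x r \<Longrightarrow> (\<lambda>n. c n * (z - x) ^ n) sums g z"
      unfolding B_space_def by blast
    from h x obtain d where d: "\<And>z. z \<in> ball x r \<Longrightarrow> (\<lambda>n. d n * (z - x) ^ n) sums h z"
      unfolding B_space_def by blast
    have "(\<lambda>n. (a * c n + b * d n) * (z - x) ^ n) sums (a * g z + b * h z)" if "z \<in> ball x r" for z
      using nonarch_sums_add[OF nonarch_sums_mult[OF c[OF that], of a]
        nonarch_sums_mult[OF d[OF that], of b]]
      by (simp add: algebra_simps)
    then show ?thesis
      by (intro exI[of _ "\<lambda>n. a * c n + b * d n"]) blast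
  qed
  moreover
  obtain M where M: "\<And>z. z \<in> disc_nbhd \<sigma> r \<Longrightarrow> vabs (g z) \<le> M"
    using g unfolding B_space_def bdd_above_def by auto
  obtain M' where M': "\<And>z. z \<in> disc_nbhd \<sigma> r \<Longrightarrow> vabs (h z) \<le> M'"
    using h unfolding B_space_def bdd_above_def by auto
  have "vabs (a * g z + b * h z) \<le> max (vabs a * M) (vabs b * M')" if "z \<in> disc_nbhd \<sigma> r" for z
    using vabs_add_le_max[of "a * g z" "b * h z"] M[OF that] M'[OF that]
      mult_left_mono[of "vabs (g z)" M "vabs a"] mult_left_mono[of "vabs (h z)" M' "vabs b"]
    by (simp add: vabs_mult)
  then have "bdd_above ((\<lambda>z. vabs (a * g z + b * h z)) ` disc_nbhd \<sigma> r)"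
    by (auto simp: bdd_above_def)
  ultimately show ?thesis
    unfolding B_space_def by simp
qed

lemma loc_anI: "0 < r \<Longrightarrow> g \<in> B_space \<sigma> r \<Longrightarrow> g \<in> loc_an \<sigma>"
  by (auto simp: loc_an_def)

lemma loc_an_lincomb:
  fixes g h :: "'a \<Rightarrow> 'a"
  assumes "g \<in> loc_an \<sigma>" "h \<in> loc_an \<sigma>"
  shows "(\<lambda>x. a * g x + b * h x) \<in> loc_an \<sigma>"
proof -
  from assms obtain r r' where r: "r > 0" "r' > 0" "g \<in> B_space \<sigma> r" "h \<in> B_space \<sigma> r'"
    unfolding loc_an_def by auto
  then have "g \<in> B_space \<sigma> (min r r')" "h \<in> B_space \<sigma> (min r r')"
    by (auto intro: B_space_antimono)
  then show ?thesis
    using r by (intro loc_anI[of "min r r'"] B_space_lincomb) auto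
qed

lemma loc_an_scale: "g \<in> loc_an \<sigma> \<Longrightarrow> (\<lambda>x. c * g x :: 'a) \<in> loc_an \<sigma>"
  using loc_an_lincomb[of g \<sigma> g c 0] by simp

lemma loc_an_add:
  "g \<in> loc_an \<sigma> \<Longrightarrow> h \<in> loc_an \<sigma> \<Longrightarrow> (\<lambda>x. g x + h x :: 'a) \<in> loc_an \<sigma>"
  using loc_an_lincomb[of g \<sigma> h 1 1] by simp

lemma loc_an_zero: "(\<lambda>x. 0 :: 'a) \<in> loc_an \<sigma>"
proof (rule loc_anI)
  have "(\<lambda>n. 0 * (z - a) ^ n) sums (0 :: 'a)" for z a :: 'a
    by (simp add: sums_def)
  then show "(\<lambda>x. 0 :: 'a) \<in> B_space \<sigma> 1"
    unfolding B_space_def by (auto simp: bdd_above_def intro!: exI[of _ "\<lambda>_. 0"])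
qed simp

lemma loc_an_sum:
  "(\<And>i. i \<in> A \<Longrightarrow> g i \<in> loc_an \<sigma>) \<Longrightarrow> (\<lambda>x. \<Sum>i\<in>A. g i x :: 'a) \<in> loc_an \<sigma>"
  by (induction A rule: infinite_finite_induct) (simp_all add: loc_an_zero loc_an_add)

text \<open>\<open>loc_an \<sigma>\<close> is itself a neighbourhood of 0 and closed under addition,
  hence open.\<close>

lemma loc_an_in_topspace: "(g :: 'a \<Rightarrow> 'a) \<in> loc_an \<sigma> \<Longrightarrow> g \<in> topspace (loc_an_topology \<sigma>)"
proof -
  have "zero_nbhd \<sigma> (loc_an \<sigma> :: ('a \<Rightarrow> 'a) set)"
    unfolding zero_nbhd_def by (auto simp: loc_an_lincomb loc_anI intro!: exI[of _ 1])
  then have "loc_an_open \<sigma> (loc_an \<sigma> :: ('a \<Rightarrow> 'a) set)"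
    unfolding loc_an_open_def using loc_an_add by blast
  then show "g \<in> loc_an \<sigma> \<Longrightarrow> g \<in> topspace (loc_an_topology \<sigma>)"
    using openin_subset[of "loc_an_topology \<sigma>" "loc_an \<sigma>"] by (auto simp: openin_loc_an_topology)
qed

text \<open>Recentring at \<open>a\<close> in \<open>\<sigma>\<close>:
  \<open>u + \<kappa> * z\<close> is \<open>w + t\<close> with \<open>w = u + \<kappa> * a\<close>
  and \<open>t = \<kappa> * (z - a)\<close>. Both are bounded by \<open>\<rho>\<close>, so
  \<open>sums_binomial_rearrange\<close> yields a series in \<open>t\<close>, hence in
  \<open>z - a\<close>.\<close>

lemma power_series_in_B_space:
  fixes \<sigma> :: "'a set"
  assumes \<rho>: "0 < \<rho>" and \<beta>: "0 \<le> \<beta>" "\<beta> * \<rho> < 1" and \<kappa>: "vabs \<kappa> * r \<le> \<rho>"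
    and u: "\<And>z. z \<in> disc_nbhd \<sigma> r \<Longrightarrow> vabs (u + \<kappa> * z) \<le> \<rho>"
    and b: "\<And>n. vabs (b n) \<le> B * \<beta> ^ n"
    and g: "\<And>z. z \<in> disc_nbhd \<sigma> r \<Longrightarrow> (\<lambda>n. b n * (u + \<kappa> * z) ^ n) sums g z"
  shows "g \<in> B_space \<sigma> r"
proof -
  have "\<exists>c. \<forall>z\<in>ball a r. (\<lambda>n. c n * (z - a) ^ n) sums g z" if a: "a \<in> \<sigma>" for a
  proof (cases "r > 0")
    case True
    then have "a \<in> disc_nbhd \<sigma> r"
      using a by (force simp: disc_nbhd_def)
    define w where "w = u + \<kappa> * a"
    have w: "vabs (w ^ n) \<le> 1 * \<rho> ^ n" for n
      using u[OF \<open>a \<in> disc_nbhd \<sigma> r\<close>] by (auto simp: w_def vabs_power intro!: power_mono)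
    obtain c where
      c: "\<And>t S. vabs t \<le> \<rho> \<Longrightarrow>
            (\<lambda>n. b n * (\<Sum>k\<le>n. of_nat (n choose k) * w ^ (n - k) * t ^ k)) sums S
          \<Longrightarrow> (\<lambda>k. c k * t ^ k) sums S"
      by (rule sums_binomial_rearrange[OF \<rho> \<beta> b w]) blast
    have "(\<lambda>n. (c n * \<kappa> ^ n) * (z - a) ^ n) sums g z" if z: "z \<in> ball a r" for z
    proof -
      have zd: "z \<in> disc_nbhd \<sigma> r"
        using a z by (auto simp: disc_nbhd_def)
      define t where "t = \<kappa> * (z - a)"
      have "vabs (z - a) < r"
        using z by (simp add: dist_commute flip: dist_vabs)
      then have "vabs t \<le> \<rho>"
        using \<kappa> mult_left_mono[of "vabs (z - a)" r "vabs \<kappa>"] by (simp add: t_def vabs_mult)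
      moreover have "u + \<kappa> * z = t + w"
        by (simp add: t_def w_def algebra_simps)
      then have "(u + \<kappa> * z) ^ n = (\<Sum>k\<le>n. of_nat (n choose k) * w ^ (n - k) * t ^ k)" for n
        by (simp add: binomial_ring mult_ac)
      then have "(\<lambda>n. b n * (\<Sum>k\<le>n. of_nat (n choose k) * w ^ (n - k) * t ^ k)) sums g z"
        using g[OF zd] by simp
      ultimately have "(\<lambda>k. c k * t ^ k) sums g z"
        by (rule c)
      then show ?thesis
        by (simp add: t_def power_mult_distrib mult_ac)
    qed
    then show ?thesis
      by (intro exI[of _ "\<lambda>n. c n * \<kappa> ^ n"]) blast
  qed (simp add: ball_empty)
  moreover have "vabs (g z) \<le> B" if z: "z \<in> disc_nbhd \<sigma> r" for z
  proof (rule sums_vabs_le[OF g[OF z]])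
    fix n
    have "0 \<le> B"
      using b[of 0] vabs_nonneg[of "b 0"] by (simp del: vabs_nonneg)
    have "vabs (b n * (u + \<kappa> * z) ^ n) \<le> B * \<beta> ^ n * \<rho> ^ n"
      using u[OF z] by (intro vabs_mult_le b) (auto simp: vabs_power intro!: power_mono)
    also have "\<dots> = B * (\<beta> * \<rho>) ^ n"
      by (simp add: power_mult_distrib)
    also have "\<dots> \<le> B * 1"
      using \<open>0 \<le> B\<close> \<rho> \<beta> by (intro mult_left_mono power_le_one) auto
    finally show "vabs (b n * (u + \<kappa> * z) ^ n) \<le> B"
      by simp
  qed
  then have "bdd_above ((\<lambda>z. vabs (g z)) ` disc_nbhd \<sigma> r)"
    by (auto simp: bdd_above_def)
  ultimately show ?thesis
    unfolding B_space_def by simp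
qed

section \<open>Generalized distributions\<close>

lemma gen_dist_add:
  "\<nu> \<in> gen_dist \<sigma> \<Longrightarrow> g \<in> loc_an \<sigma> \<Longrightarrow> h \<in> loc_an \<sigma> \<Longrightarrow> \<nu> (\<lambda>x. g x + h x) = \<nu> g + \<nu> h"
  by (simp add: gen_dist_def)

lemma gen_dist_scale:
  "\<nu> \<in> gen_dist \<sigma> \<Longrightarrow> g \<in> loc_an \<sigma> \<Longrightarrow> \<nu> (\<lambda>x. c * g x) = c * \<nu> g"
  by (simp add: gen_dist_def)

lemma gen_dist_zero: "\<nu> \<in> gen_dist \<sigma> \<Longrightarrow> \<nu> (\<lambda>x. 0 :: 'a) = 0"
  using gen_dist_scale[OF _ loc_an_zero, of \<nu> \<sigma> 0] by simp

lemma gen_dist_sum: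
  assumes "\<nu> \<in> gen_dist \<sigma>" "\<And>i. i \<in> A \<Longrightarrow> g i \<in> loc_an \<sigma>"
  shows "\<nu> (\<lambda>x. \<Sum>i\<in>A. c i * g i x) = (\<Sum>i\<in>A. c i * \<nu> (g i) :: 'a)"
  using assms(2)
proof (induction A rule: infinite_finite_induct)
  case (insert i A)
  then show ?case
    using assms(1) gen_dist_add[OF assms(1), of "\<lambda>x. c i * g i x" "\<lambda>x. \<Sum>i\<in>A. c i * g i x"]
    by (simp add: gen_dist_scale loc_an_scale loc_an_sum)
qed (simp_all add: gen_dist_zero[OF assms(1)])

text \<open>Continuity bounds the functional on a small ball of \<open>B_space \<sigma> r\<close>,
  and rescaling by powers of \<open>p\<close> turns this into a norm estimate with
  \<open>C = p ^ j\<close>. Restricting to bounds \<open>\<theta> ^ k\<close> keeps the scalars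
  powers of \<open>p\<close>.\<close>

lemma gen_dist_bounded:
  fixes \<sigma> :: "'a set"
  assumes \<nu>: "\<nu> \<in> gen_dist \<sigma>" and r: "r > 0" and \<sigma>: "\<sigma> \<noteq> {}"
  obtains C where "\<And>g k. g \<in> B_space \<sigma> r \<Longrightarrow> (\<And>z. z \<in> disc_nbhd \<sigma> r \<Longrightarrow> vabs (g z) \<le> \<theta> ^ k)
    \<Longrightarrow> vabs (\<nu> g) \<le> C * \<theta> ^ k"
proof -
  \<comment> \<open>The preimage of the open unit ball is an open set around the zero function. So
    it contains a basic neighbourhood \<open>V\<close>, which in turn contains a small ball of
    \<open>B_space \<sigma> r\<close>.\<close>
  define U where "U = {g \<in> topspace (loc_an_topology \<sigma>). \<nu> g \<in> ball 0 1}"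
  have "openin (loc_an_topology \<sigma>) U"
    unfolding U_def using \<nu> by (intro openin_continuous_map_preimage) (auto simp: gen_dist_def)
  moreover have "(\<lambda>x. 0) \<in> U"
    by (simp add: U_def loc_an_zero loc_an_in_topspace gen_dist_zero[OF \<nu>])
  ultimately obtain V where V: "zero_nbhd \<sigma> V" "\<And>h. h \<in> V \<Longrightarrow> h \<in> U"
    unfolding openin_loc_an_topology loc_an_open_def by fastforce
  then obtain \<epsilon> where \<epsilon>: "\<epsilon> > 0" "\<And>g. g \<in> B_space \<sigma> r \<Longrightarrow> B_norm \<sigma> r g < \<epsilon> \<Longrightarrow> g \<in> V"
    using r unfolding zero_nbhd_def by meson
  obtain j where j: "\<theta> ^ j < \<epsilon>"
    using real_arch_pow_inv[OF \<epsilon>(1) theta_lt_1] by blast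
  have ne: "disc_nbhd \<sigma> r \<noteq> {}"
    using \<sigma> r by (force simp: disc_nbhd_def)
  show ?thesis
  proof (rule that[of "real p ^ j"])
    fix g :: "'a \<Rightarrow> 'a" and k
    assume g: "g \<in> B_space \<sigma> r" and le: "\<And>z. z \<in> disc_nbhd \<sigma> r \<Longrightarrow> vabs (g z) \<le> \<theta> ^ k"
    define c :: 'a where "c = of_nat p ^ j / of_nat p ^ k"
    have c: "vabs c = \<theta> ^ j / \<theta> ^ k"
      by (simp add: c_def vabs_divide vabs_power vabs_p)
    have "(\<lambda>x. c * g x) \<in> B_space \<sigma> r"
      using B_space_lincomb[OF g g, of c 0] by simp
    moreover have "B_norm \<sigma> r (\<lambda>x. c * g x) \<le> \<theta> ^ j"
      unfolding B_norm_def
    proof (rule cSUP_least[OF ne])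
      fix z assume "z \<in> disc_nbhd \<sigma> r"
      from vabs_mult_le[OF order_refl le[OF this], of c] show "vabs (c * g z) \<le> \<theta> ^ j"
        using theta_gt_0 by (simp add: c)
    qed
    ultimately have "(\<lambda>x. c * g x) \<in> U"
      using j by (intro V \<epsilon>) auto
    then have "vabs (c * \<nu> g) < 1"
      using gen_dist_scale[OF \<nu> loc_anI[OF r g], of c]
      by (auto simp: U_def dist_commute vabs_def)
    then show "vabs (\<nu> g) \<le> real p ^ j * \<theta> ^ k"
      using p_gt_1 by (simp add: vabs_mult c power_divide field_simps)
  qed
qed

end

section \<open>Divided differences\<close>

text \<open>The divided differences of \<open>\<Prod>i<j. (1 - s - i)\<close> as polynomials, which also make sense at
  lists with repeated entries.\<close>

fun falling_diff_quot :: "nat \<Rightarrow> 'a::field_char_0 list \<Rightarrow> 'a" where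
  "falling_diff_quot 0 xs = (if length xs = 1 then 1 else 0)"
| "falling_diff_quot (Suc j) [] = 0"
| "falling_diff_quot (Suc j) (x # xs) =
     (1 - of_nat j - x) * falling_diff_quot j (x # xs) - falling_diff_quot j xs"

lemma diff_quot_const: "diff_quot (\<lambda>_. c) xs = (if length xs = 1 then c else 0)"
  by (induction "\<lambda>_::'a. c" xs rule: diff_quot.induct) auto

text \<open>Leibniz rule: the linear factor \<open>c - s\<close> has first divided difference -1 and
  vanishing higher ones, so two terms survive. Distinctness allows \<open>x - y\<close> to be
  cancelled.\<close>

lemma diff_quot_linear_mult:
  "distinct (x # xs) \<Longrightarrow>
     diff_quot (\<lambda>s. (c - s) * f s) (x # xs) = (c - x) * diff_quot f (x # xs) - diff_quot f xs"
proof (induction xs arbitrary: x)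
  case (Cons y zs)
  define A B D where "A = diff_quot f (x # zs)" and "B = diff_quot f (y # zs)" and "D = diff_quot f zs"
  have "x - y \<noteq> 0"
    using Cons.prems by auto
  have "diff_quot (\<lambda>s. (c - s) * f s) (x # y # zs)
      = (((c - x) * A - D) - ((c - y) * B - D)) / (x - y)"
    using Cons by (simp add: A_def B_def D_def)
  also have "\<dots> = ((c - x) * (A - B) - (x - y) * B) / (x - y)"
    by (simp add: algebra_simps)
  also have "\<dots> = (c - x) * ((A - B) / (x - y)) - B"
    using \<open>x - y \<noteq> 0\<close> by (subst diff_divide_distrib) simp
  finally show ?case
    by (simp add: A_def B_def)
qed simp

text \<open>The Leibniz rule, applied to the last factor of the product, reproduces the recursion of
  \<open>falling_diff_quot\<close>.\<close>

lemma diff_quot_falling: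
  "distinct xs \<Longrightarrow> diff_quot (\<lambda>s. \<Prod>i<j. (1 - s - of_nat i)) xs = falling_diff_quot j xs"
proof (induction j arbitrary: xs)
  case 0
  then show ?case
    by (simp add: diff_quot_const)
next
  case (Suc j)
  show ?case
  proof (cases xs)
    case (Cons x ys)
    have "(\<lambda>s::'a. \<Prod>i<Suc j. (1 - s - of_nat i))
        = (\<lambda>s. ((1 - of_nat j) - s) * (\<Prod>i<j. (1 - s - of_nat i)))"
      by (rule ext) (simp add: algebra_simps)
    then show ?thesis
      using Suc Cons diff_quot_linear_mult[of x ys "1 - of_nat j" "\<lambda>s. \<Prod>i<j. (1 - s - of_nat i)"]
      by simp
  qed simp
qed

context padic_field
begin

section \<open>Difference quotients of falling factorial series\<close>

lemma vabs_falling_diff_quot: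
  "(\<And>x. x \<in> set xs \<Longrightarrow> vabs (x::'a) \<le> 1) \<Longrightarrow> vabs (falling_diff_quot j xs) \<le> 1"
proof (induction j arbitrary: xs)
  case (Suc j)
  show ?case
  proof (cases xs)
    case (Cons x ys)
    have "vabs (1 - of_nat j - x) \<le> 1"
      using Suc.prems Cons by (intro vabs_diff_le vabs_of_nat_le_1) auto
    then show ?thesis
      using Suc.IH[of xs] Suc.IH[of ys] Suc.prems Cons
      by (simp add: vabs_diff_le vabs_mult_le_right)
  qed simp
qed simp

text \<open>The recursion uses only ring operations on elements of the unit ball, so the difference
  splits into three terms of size at most \<open>\<delta>\<close>. Nodes may coincide, which is what
  a continuous extension to all tuples in \<open>Zp\<close> needs.\<close>

lemma falling_diff_quot_lipschitz:
  "list_all2 (\<lambda>x y. vabs (x::'a) \<le> 1 \<and> vabs y \<le> 1 \<and> vabs (x - y) \<le> \<delta>) xs ys \<Longrightarrow> 0 \<le> \<delta> \<Longrightarrow>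
     vabs (falling_diff_quot j xs - falling_diff_quot j ys) \<le> \<delta>"
proof (induction j arbitrary: xs ys)
  case 0
  then show ?case
    by (auto dest: list_all2_lengthD)
next
  case (Suc j)
  show ?case
  proof (cases xs)
    case Nil
    then show ?thesis
      using Suc.prems by simp
  next
    case (Cons x xs')
    then obtain y ys' where ys: "ys = y # ys'"
      using Suc.prems by (auto simp: list_all2_Cons1)
    define A A' B B' where "A = falling_diff_quot j xs" and "A' = falling_diff_quot j xs'"
      and "B = falling_diff_quot j ys" and "B' = falling_diff_quot j ys'"
    have AB: "vabs (A - B) \<le> \<delta>" "vabs (A' - B') \<le> \<delta>"
      using Suc Cons ys by (auto simp: A_def B_def A'_def B'_def)
    have "\<And>z. z \<in> set ys \<Longrightarrow> vabs z \<le> 1"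
      using Suc.prems(1) by (auto simp: list_all2_conv_all_nth in_set_conv_nth)
    then have B: "vabs B \<le> 1"
      unfolding B_def by (rule vabs_falling_diff_quot)
    have xy: "vabs (x - y) \<le> \<delta>" "vabs (1 - of_nat j - x) \<le> 1"
      using Suc.prems Cons ys by (auto intro!: vabs_diff_le vabs_of_nat_le_1)
    have "falling_diff_quot (Suc j) xs - falling_diff_quot (Suc j) ys
        = (1 - of_nat j - x) * (A - B) - B * (x - y) - (A' - B')"
      using Cons ys by (simp add: A_def B_def A'_def B'_def algebra_simps)
    also have "vabs \<dots> \<le> \<delta>"
      by (intro vabs_diff_le vabs_mult_le_right AB xy B)
    finally show ?thesis .
  qed
qed

text \<open>At fixed nodes a divided difference is a finite linear combination of values, so it
  commutes with the series.\<close>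

lemma diff_quot_sums:
  assumes "\<And>s. s \<in> S \<Longrightarrow> (\<lambda>j. a j * q j s) sums (g s :: 'a)"
  shows "set xs \<subseteq> S \<Longrightarrow> (\<lambda>j. a j * diff_quot (q j) xs) sums diff_quot g xs"
proof (induction "length xs" arbitrary: xs rule: less_induct)
  case less
  show ?case
  proof (cases "(g, xs)" rule: diff_quot.cases)
    case (3 _ x y zs)
    then have "(\<lambda>j. a j * diff_quot (q j) (x # zs)) sums diff_quot g (x # zs)"
      "(\<lambda>j. a j * diff_quot (q j) (y # zs)) sums diff_quot g (y # zs)"
      using less by auto
    from nonarch_sums_mult[OF nonarch_sums_diff[OF this], of "inverse (x - y)"] show ?thesis
      using 3 by (simp add: divide_inverse algebra_simps)
  qed (use less.prems assms in \<open>auto simp: sums_def\<close>)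
qed

text \<open>The divided differences of the products are polynomials, bounded by 1 and 1-Lipschitz on
  \<open>Zp\<close>. Hence the series of \<open>a j * falling_diff_quot j\<close> converges at all
  lists of nodes, repeated ones included, and is Lipschitz with constant \<open>C\<close>. This is
  the required extension.\<close>

lemma C_infinity_falling_series:
  assumes a: "\<And>j. vabs (a j :: 'a) \<le> C * q ^ j" and q: "0 \<le> q" "q < 1"
    and g: "\<And>s. s \<in> Zp \<Longrightarrow> (\<lambda>j. a j * (\<Prod>i<j. (1 - s - of_nat i))) sums g s"
  shows "C_infinity_Zp g"
  unfolding C_infinity_Zp_def C_n_Zp_def
proof
  fix n :: nat
  let ?X = "product_topology (\<lambda>_. top_of_set (Zp :: 'a set)) {..n}"
  define L where "L x = map x [0..<Suc n]" for x :: "nat \<Rightarrow> 'a"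
  have C: "0 \<le> C"
    using a[of 0] vabs_nonneg[of "a 0"] by (simp del: vabs_nonneg)
  have L: "set (L x) \<subseteq> Zp" if "x \<in> {..n} \<rightarrow>\<^sub>E Zp" for x
    using that by (fastforce simp: L_def PiE_iff)
  define G where "G x = (\<Sum>j. a j * falling_diff_quot j (L x))" for x
  have G: "(\<lambda>j. a j * falling_diff_quot j (L x)) sums G x" if "x \<in> {..n} \<rightarrow>\<^sub>E Zp" for x
  proof -
    have "vabs (a j * falling_diff_quot j (L x)) \<le> C * q ^ j" for j
      using L[OF that] vabs_le_1_if_Zp vabs_mult_le[OF a vabs_falling_diff_quot, of "L x" j j] by auto
    from nonarch_summable[OF this q] show ?thesis
      unfolding G_def by (metis sums_unique)
  qed
  have lip: "vabs (G x - G y) \<le> C * \<delta>"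
    if xy: "x \<in> {..n} \<rightarrow>\<^sub>E Zp" "y \<in> {..n} \<rightarrow>\<^sub>E Zp" and \<delta>: "0 \<le> \<delta>" "\<And>i. i \<le> n \<Longrightarrow> vabs (x i - y i) \<le> \<delta>"
    for x y \<delta>
  proof (rule sums_vabs_le[OF nonarch_sums_diff[OF G G, OF xy]])
    fix j
    have "list_all2 (\<lambda>x y. vabs x \<le> 1 \<and> vabs y \<le> 1 \<and> vabs (x - y) \<le> \<delta>) (L x) (L y)"
      using xy \<delta> vabs_le_1_if_Zp unfolding L_def list_all2_conv_all_nth
      by (auto simp: PiE_iff less_Suc_eq_le simp del: upt_Suc)
    then have "vabs (falling_diff_quot j (L x) - falling_diff_quot j (L y)) \<le> \<delta>"
      using \<delta>(1) by (rule falling_diff_quot_lipschitz)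
    moreover have "C * q ^ j \<le> C * 1"
      using C q by (intro mult_left_mono power_le_one) auto
    then have "vabs (a j) \<le> C"
      using a[of j] by linarith
    ultimately show "vabs (a j * falling_diff_quot j (L x) - a j * falling_diff_quot j (L y)) \<le> C * \<delta>"
      using vabs_mult_le by (simp flip: right_diff_distrib)
  qed
  have "continuous_map ?X euclidean G"
    unfolding continuous_map_def
  proof (intro conjI allI impI)
    fix U :: "'a set" assume "openin euclidean U"
    then have U: "open U"
      by simp
    show "openin ?X {x \<in> topspace ?X. G x \<in> U}"
    proof (subst openin_subopen, intro ballI)
      fix x assume "x \<in> {x \<in> topspace ?X. G x \<in> U}"
      then have x: "x \<in> {..n} \<rightarrow>\<^sub>E Zp" "G x \<in> U"
        by auto
      obtain e where e: "e > 0" "ball (G x) e \<subseteq> U"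
        using U x(2) open_contains_ball by blast
      define \<delta> where "\<delta> = e / (C + 1)"
      have \<delta>: "\<delta> > 0"
        using e C by (simp add: \<delta>_def)
      have C\<delta>: "C * \<delta> < e"
        using \<delta> C by (simp add: \<delta>_def field_simps)
      \<comment> \<open>A box over the finite index set \<open>{..n}\<close>, hence open in the
        product topology.\<close>
      define W where "W = (\<Pi>\<^sub>E i\<in>{..n}. Zp \<inter> ball (x i) \<delta>)"
      have "openin ?X W"
        by (simp add: W_def openin_PiE openin_open_Int)
      moreover have "x \<in> W"
        using x \<delta> by (auto simp: W_def PiE_iff)
      moreover have "y \<in> topspace ?X \<and> G y \<in> U" if "y \<in> W" for y
      proof -
        have y: "y \<in> {..n} \<rightarrow>\<^sub>E Zp"
          using that by (auto simp: W_def PiE_iff)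
        have "vabs (x i - y i) \<le> \<delta>" if "i \<le> n" for i
          using \<open>y \<in> W\<close> that by (auto simp: W_def PiE_iff dist_vabs less_imp_le)
        then have "vabs (G x - G y) \<le> C * \<delta>"
          using lip[OF x(1) y] \<delta> by simp
        then have "G y \<in> ball (G x) e"
          using C\<delta> by (simp add: dist_vabs)
        then show ?thesis
          using e y by auto
      qed
      ultimately show "\<exists>W. openin ?X W \<and> x \<in> W \<and> W \<subseteq> {x \<in> topspace ?X. G x \<in> U}"
        by blast
    qed
  qed simp
  \<comment> \<open>At distinct nodes the polynomials are the actual difference quotients, and
    differencing term by term identifies \<open>G\<close> with that of \<open>g\<close>.\<close>
  moreover have "G x = diff_quot g (map x [0..<Suc n])" if x: "x \<in> {..n} \<rightarrow>\<^sub>E Zp" "inj_on x {..n}" for x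
  proof -
    have "distinct (L x)"
      using x(2) by (auto simp: L_def distinct_map atLeast0LessThan lessThan_Suc_atMost simp del: upt_Suc)
    then have "(\<lambda>j. a j * falling_diff_quot j (L x)) sums diff_quot g (L x)"
      using diff_quot_sums[where q = "\<lambda>j s. \<Prod>i<j. (1 - s - of_nat i)", OF g L[OF x(1)]]
      by (simp add: diff_quot_falling)
    with G[OF x(1)] show ?thesis
      unfolding L_def by (rule sums_unique2)
  qed
  ultimately show "\<exists>G. continuous_map ?X euclidean G \<and>
      (\<forall>x\<in>{..n} \<rightarrow>\<^sub>E Zp. inj_on x {..n} \<longrightarrow> G x = diff_quot g (map x [0..<Suc n]))"
    by blast
qed

end

section \<open>The projection on a ball away from the origin\<close>

text \<open>\<open>P\<close> turns sums into products and \<open>P 1\<close> is nonzero, which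
  forces \<open>P 0 = 1\<close>. The arguments of \<open>angle\<close> met later have valuation
  \<open>- N\<close>, so this is the value that enters \<open>omega_v\<close>.\<close>

lemma fractional_powers_neg_nat:
  assumes "fractional_powers p P" "p > 0"
  shows "P (- of_nat N) = 1 / of_nat p ^ N"
proof -
  have add: "P (r + r') = P r * P r'" and P1: "P 1 = of_nat p" for r r'
    using assms(1) by (auto simp: fractional_powers_def)
  have P0: "P 0 = 1"
    using add[of 1 0] P1 assms(2) by simp
  have "P (of_nat N) = of_nat p ^ N"
    by (induction N) (simp_all add: P0 P1 add)
  then show ?thesis
    using add[of "of_nat N" "- of_nat N"] P0 assms(2) by (simp add: field_simps)
qed

context padic_field
begin

lemma p_nonzero: "(of_nat p :: 'a) \<noteq> 0"
  using p_gt_1 by auto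

lemma vabs_near_one: "vabs (u - 1 :: 'a) < 1 \<Longrightarrow> vabs u = 1"
proof -
  assume "vabs (u - 1) < 1"
  then show ?thesis
    using vabs_add_le_max[of "u - 1" 1] vabs_add_le_max[of u "1 - u"] vabs_minus[of "u - 1"]
    by simp
qed

lemma vabs_power_minus_one: "vabs u \<le> 1 \<Longrightarrow> vabs (u ^ i - 1 :: 'a) \<le> vabs (u - 1)"
proof -
  assume u: "vabs u \<le> 1"
  have "vabs (\<Sum>j<i. u ^ j) \<le> 1"
    using u by (intro vabs_sum_le) (auto simp: vabs_power power_le_one)
  then show ?thesis
    using vabs_mult_le_right[OF _ order_refl] by (metis power_diff_1_eq mult.commute)
qed

text \<open>Each \<open>p\<close>-th power gains a factor \<open>\<theta>\<close>: in
  \<open>v ^ p - 1 = (v - 1) * (\<Sum>i<p. v ^ i)\<close> every summand is within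
  \<open>\<theta>\<close> of 1, so the sum is within \<open>\<theta>\<close> of \<open>p\<close> and
  has absolute value at most \<open>\<theta>\<close>.\<close>

lemma vabs_p_power_minus_one:
  assumes u: "vabs (u - 1 :: 'a) \<le> \<theta>"
  shows "vabs (u ^ (p ^ n) - 1) \<le> \<theta> ^ Suc n"
proof (induction n)
  case 0
  then show ?case
    using u by simp
next
  case (Suc n)
  define v where "v = u ^ (p ^ n)"
  have v1: "vabs (v - 1) \<le> \<theta> ^ Suc n"
    using Suc by (simp add: v_def)
  moreover have "\<theta> ^ Suc n \<le> \<theta> * 1"
    unfolding power_Suc using theta_gt_0 theta_power_le_1 by (intro mult_left_mono) auto
  ultimately have v\<theta>: "vabs (v - 1) \<le> \<theta>"
    by linarith
  then have v: "vabs v \<le> 1"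
    using vabs_near_one[of v] theta_lt_1 by simp
  have "vabs (v ^ i - 1) \<le> \<theta>" for i
    using vabs_power_minus_one[OF v, of i] v\<theta> by linarith
  then have "vabs ((\<Sum>i<p. v ^ i - 1) + of_nat p) \<le> \<theta>"
    using theta_gt_0 by (intro vabs_add_le vabs_sum_le) (auto simp: vabs_p)
  then have "vabs (\<Sum>i<p. v ^ i) \<le> \<theta>"
    by (simp add: sum_subtractf)
  with v1 have "vabs ((v - 1) * (\<Sum>i<p. v ^ i)) \<le> \<theta> ^ Suc n * \<theta>"
    by (rule vabs_mult_le)
  moreover have "u ^ (p ^ Suc n) = v ^ p"
    by (simp add: v_def mult.commute flip: power_mult)
  ultimately show ?case
    by (simp only: power_diff_1_eq power_Suc2)
qed

text \<open>The hypothesis forces \<open>vabs a = p ^ N\<close>, hence valuation \<open>- N\<close>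
  and unit part \<open>p ^ N * a\<close>. That unit is close enough to 1 for its powers with
  exponents \<open>p ^ fact n\<close> to tend to 1, so \<open>hat\<close> is 1 and
  \<open>omega_v\<close> is \<open>1 / p ^ N\<close>.\<close>

lemma angle_near_p_power:
  assumes P: "fractional_powers p P" and a: "vabs (of_nat p ^ N * a - 1 :: 'a) \<le> \<theta>"
  shows "angle p P a = of_nat p ^ N * a"
proof -
  define u where "u = of_nat p ^ N * a"
  have "vabs u = 1"
    using vabs_near_one[of u] a theta_lt_1 by (simp add: u_def)
  then have "\<theta> ^ N * vabs a = 1"
    by (simp add: u_def vabs_mult vabs_power vabs_p)
  then have va: "vabs a = real p powr real N"
    using p_gt_1 by (simp add: powr_realpow power_divide field_simps)
  have "vp p a = - of_nat N"
    unfolding vp_def va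
  proof (rule the_equality)
    fix r assume "real p powr real N = real p powr - real_of_rat r"
    then have "real_of_rat r = real_of_rat (- of_nat N)"
      using p_gt_1 by (simp add: powr_inj of_rat_minus)
    then show "r = - of_nat N"
      by (simp only: of_rat_eq_iff)
  qed (simp add: of_rat_minus)
  then have Pv: "P (vp p a) = 1 / of_nat p ^ N"
    using fractional_powers_neg_nat[OF P] p_gt_1 by simp
  have "(\<lambda>n. u ^ (p ^ fact n)) \<longlonglongrightarrow> 1"
  proof (rule LIMSEQ_geometric_bound[of _ _ 1 \<theta>])
    fix n
    have "n \<le> Suc (fact n)"
      using fact_ge_self[of n] by linarith
    then have "\<theta> ^ Suc (fact n) \<le> \<theta> ^ n"
      using theta_gt_0 theta_lt_1 by (intro power_decreasing) auto
    then show "vabs (u ^ (p ^ fact n) - 1) \<le> 1 * \<theta> ^ n"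
      using vabs_p_power_minus_one[OF a[folded u_def], of "fact n"] by linarith
  qed (use theta_gt_0 theta_lt_1 in auto)
  then have "hat p P a = 1"
    unfolding hat_def Pv by (intro limI) (simp add: u_def mult.commute)
  then show ?thesis
    by (simp add: angle_def omega_v_def Pv mult.commute)
qed

lemma vabs_gbinomial_le:
  assumes "vabs (s::'a) \<le> 1"
  shows "vabs (s gchoose n) \<le> real p ^ n"
proof -
  have "vabs (s - of_nat i) \<le> 1" for i
    using assms by (intro vabs_diff_le vabs_of_nat_le_1)
  then have "vabs (\<Prod>i = 0..<n. s - of_nat i) \<le> 1"
    unfolding vabs_prod by (intro prod_le_1) auto
  then have "vabs (s gchoose n) \<le> 1 / vabs (fact n :: 'a)"
    by (simp add: gbinomial_prod_rev vabs_divide divide_right_mono)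
  also have "\<dots> \<le> 1 / \<theta> ^ n"
    by (rule frac_le[OF _ _ _ vabs_fact_ge]) (use theta_gt_0 in simp_all)
  finally show ?thesis
    by (simp add: power_divide)
qed

text \<open>These facts make the radius \<open>\<theta> ^ 3\<close> work: it lies within the range
  \<open>\<theta>\<close> of \<open>angle_near_p_power\<close>, and after the loss of a factor
  \<open>p\<close> per degree in the binomial coefficients a ratio \<open>\<theta> ^ 2 < 1\<close>
  remains.\<close>

lemma theta_cube: "0 < \<theta> ^ 3" "\<theta> ^ 3 \<le> \<theta>" "real p * \<theta> ^ 3 = \<theta> ^ 2" "\<theta> ^ 2 < 1"
proof -
  show "0 < \<theta> ^ 3"
    using theta_gt_0 by simp
  show "\<theta> ^ 3 \<le> \<theta>"
    using power_decreasing[of 1 3 \<theta>] theta_gt_0 theta_lt_1 by simp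
  show "real p * \<theta> ^ 3 = \<theta> ^ 2"
    using p_gt_1 by (simp add: power3_eq_cube power2_eq_square)
  show "\<theta> ^ 2 < 1"
    using theta_gt_0 theta_lt_1 by (simp add: power_less_one_iff)
qed

lemma series_term_le:
  assumes "vabs (b n :: 'a) \<le> real p ^ n" "vabs w \<le> \<theta> ^ 3"
  shows "vabs (b n * w ^ n) \<le> \<theta> ^ (2 * n)"
proof -
  have "vabs (b n * w ^ n) \<le> real p ^ n * (\<theta> ^ 3) ^ n"
    using assms by (intro vabs_mult_le) (auto simp: vabs_power power_mono)
  also have "\<dots> = \<theta> ^ (2 * n)"
    by (simp only: theta_cube(3) power_mult flip: power_mult_distrib)
  finally show ?thesis .
qed

text \<open>Geometric convergence with ratio \<open>\<theta> ^ 2\<close> makes the infinite sum in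
  \<open>angle_pow\<close> a genuine one.\<close>

lemma angle_pow_sums:
  assumes P: "fractional_powers p P" and a: "vabs (of_nat p ^ N * a - 1 :: 'a) \<le> \<theta> ^ 3"
    and s: "vabs s \<le> 1"
  shows "(\<lambda>n. (s gchoose n) * (of_nat p ^ N * a - 1) ^ n) sums angle_pow p P a s"
proof -
  have "vabs (of_nat p ^ N * a - 1) \<le> \<theta>"
    using a theta_cube(2) by linarith
  then have angle: "angle p P a = of_nat p ^ N * a"
    by (rule angle_near_p_power[OF P])
  have "vabs ((s gchoose n) * (of_nat p ^ N * a - 1) ^ n) \<le> 1 * (\<theta> ^ 2) ^ n" for n
    using series_term_le[of "\<lambda>n. s gchoose n" n, OF vabs_gbinomial_le[OF s] a]
    by (simp add: power_mult)
  from nonarch_summable[OF this _ theta_cube(4)] show ?thesis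
    unfolding angle_pow_def angle by (metis sums_unique zero_le_power2)
qed

section \<open>Integration of power series\<close>

text \<open>The constants \<open>\<rho> = \<theta> ^ 3\<close> and \<open>\<beta> = p\<close> suit
  series with binomial coefficients.\<close>

lemma affine_series_in_B_space:
  fixes \<sigma> :: "'a set"
  assumes "vabs \<kappa> \<le> \<theta> ^ 3" "\<And>z. z \<in> disc_nbhd \<sigma> 1 \<Longrightarrow> vabs (u + \<kappa> * z) \<le> \<theta> ^ 3"
    and "\<And>n. vabs (b n) \<le> real p ^ n"
    and "\<And>z. z \<in> disc_nbhd \<sigma> 1 \<Longrightarrow> (\<lambda>n. b n * (u + \<kappa> * z) ^ n) sums g z"
  shows "g \<in> B_space \<sigma> 1"
  by (rule power_series_in_B_space[of "\<theta> ^ 3" "real p" \<kappa> 1 \<sigma> u b 1])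
    (use assms theta_cube in auto)

lemma affine_power_in_B_space:
  fixes \<sigma> :: "'a set"
  assumes "vabs \<kappa> \<le> \<theta> ^ 3" "\<And>z. z \<in> disc_nbhd \<sigma> 1 \<Longrightarrow> vabs (u + \<kappa> * z) \<le> \<theta> ^ 3"
  shows "(\<lambda>z. (u + \<kappa> * z) ^ n) \<in> B_space \<sigma> 1"
proof (rule affine_series_in_B_space[OF assms])
  have "(\<lambda>i. (if i = n then 1 else 0) * (u + \<kappa> * z) ^ i)
      = (\<lambda>i. if i = n then (u + \<kappa> * z) ^ i else 0)" for z
    by auto
  then show "(\<lambda>i. (if i = n then 1 else 0) * (u + \<kappa> * z) ^ i) sums (u + \<kappa> * z) ^ n" for z
    using sums_single[of n "\<lambda>i. (u + \<kappa> * z) ^ i"] by simp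
qed (use p_gt_1 in \<open>auto simp: one_le_power\<close>)

text \<open>The \<open>n\<close>-th power is bounded by \<open>\<theta> ^ (3 * n)\<close> near
  \<open>\<sigma>\<close>, so \<open>gen_dist_bounded\<close> applies with
  \<open>k = 3 * n\<close>.\<close>

lemma gen_dist_moment_bound:
  fixes \<sigma> :: "'a set"
  assumes \<nu>: "\<nu> \<in> gen_dist \<sigma>" "\<sigma> \<noteq> {}"
    and \<kappa>: "vabs \<kappa> \<le> \<theta> ^ 3" and u: "\<And>z. z \<in> disc_nbhd \<sigma> 1 \<Longrightarrow> vabs (u + \<kappa> * z) \<le> \<theta> ^ 3"
  shows "\<exists>C. \<forall>n. vabs (\<nu> (\<lambda>z. (u + \<kappa> * z) ^ n)) \<le> C * (\<theta> ^ 3) ^ n"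
proof -
  obtain C where C: "\<And>g k. g \<in> B_space \<sigma> 1 \<Longrightarrow> (\<And>z. z \<in> disc_nbhd \<sigma> 1 \<Longrightarrow> vabs (g z) \<le> \<theta> ^ k)
      \<Longrightarrow> vabs (\<nu> g) \<le> C * \<theta> ^ k"
    by (rule gen_dist_bounded[OF \<nu>(1) zero_less_one \<nu>(2)]) blast
  have "vabs (\<nu> (\<lambda>z. (u + \<kappa> * z) ^ n)) \<le> C * \<theta> ^ (3 * n)" for n
    by (intro C affine_power_in_B_space \<kappa> u)
      (simp_all only: vabs_power power_mult, intro power_mono u, simp_all)
  then show ?thesis
    unfolding power_mult by blast
qed

text \<open>The remainder after \<open>K\<close> terms is bounded by
  \<open>\<theta> ^ (2 * K)\<close> near \<open>\<sigma>\<close>, so by continuity its integral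
  tends to 0 at the same rate. This justifies integration term by term.\<close>

lemma gen_dist_affine_series:
  fixes \<sigma> :: "'a set"
  assumes \<nu>: "\<nu> \<in> gen_dist \<sigma>" "\<sigma> \<noteq> {}"
    and \<kappa>: "vabs \<kappa> \<le> \<theta> ^ 3" and u: "\<And>z. z \<in> disc_nbhd \<sigma> 1 \<Longrightarrow> vabs (u + \<kappa> * z) \<le> \<theta> ^ 3"
    and b: "\<And>n. vabs (b n) \<le> real p ^ n"
    and g: "\<And>z. z \<in> disc_nbhd \<sigma> 1 \<Longrightarrow> (\<lambda>n. b n * (u + \<kappa> * z) ^ n) sums g z"
  shows "(\<lambda>n. b n * \<nu> (\<lambda>z. (u + \<kappa> * z) ^ n)) sums \<nu> g"
proof -
  define w where "w z = u + \<kappa> * z" for z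
  obtain C where C: "\<And>g k. g \<in> B_space \<sigma> 1 \<Longrightarrow> (\<And>z. z \<in> disc_nbhd \<sigma> 1 \<Longrightarrow> vabs (g z) \<le> \<theta> ^ k)
      \<Longrightarrow> vabs (\<nu> g) \<le> C * \<theta> ^ k"
    by (rule gen_dist_bounded[OF \<nu>(1) zero_less_one \<nu>(2)]) blast
  have pow: "(\<lambda>z. w z ^ n) \<in> loc_an \<sigma>" for n
    unfolding w_def by (intro loc_anI[OF zero_less_one] affine_power_in_B_space \<kappa> u)
  have "vabs ((\<Sum>n<K. b n * \<nu> (\<lambda>z. w z ^ n)) - \<nu> g) \<le> C * (\<theta> ^ 2) ^ K" for K
  proof -
    define h where "h z = g z - (\<Sum>n<K. b n * w z ^ n)" for z
    \<comment> \<open>Zeroing the first \<open>K\<close> coefficients keeps the remainder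
      \<open>h\<close> a series of the same shape, so it lies in \<open>B_space \<sigma> 1\<close>
      by the same lemma.\<close>
    define b' where "b' n = (if n < K then 0 else b n)" for n
    have b': "vabs (b' n) \<le> real p ^ n" for n
      using b by (simp add: b'_def)
    have h: "(\<lambda>n. b' n * (u + \<kappa> * z) ^ n) sums h z" if z: "z \<in> disc_nbhd \<sigma> 1" for z
    proof -
      have "(\<lambda>n. if n < K then b n * w z ^ n else 0) sums (\<Sum>n<K. b n * w z ^ n)"
        using sums_If_finite[of "\<lambda>n. n < K" "\<lambda>n. b n * w z ^ n"] by (simp add: lessThan_def)
      from nonarch_sums_diff[OF g[OF z] this] show ?thesis
        unfolding h_def w_def b'_def by (rule sums_cong[THEN iffD1, rotated]) simp
    qed
    have hB: "h \<in> B_space \<sigma> 1"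
      by (rule affine_series_in_B_space[OF \<kappa> u b' h])
    have "vabs (h z) \<le> \<theta> ^ (2 * K)" if z: "z \<in> disc_nbhd \<sigma> 1" for z
    proof (rule sums_vabs_le[OF h[OF z]])
      fix n
      show "vabs (b' n * (u + \<kappa> * z) ^ n) \<le> \<theta> ^ (2 * K)"
      proof (cases "n < K")
        case False
        then have "\<theta> ^ (2 * n) \<le> \<theta> ^ (2 * K)"
          using theta_gt_0 theta_lt_1 by (intro power_decreasing) auto
        then show ?thesis
          using series_term_le[OF b' u[OF z]] by (rule order_trans[rotated])
      qed (use theta_gt_0 in \<open>simp add: b'_def\<close>)
    qed
    then have \<nu>h: "vabs (\<nu> h) \<le> C * \<theta> ^ (2 * K)"
      by (rule C[OF hB])
    have "g = (\<lambda>z. (\<Sum>n<K. b n * w z ^ n) + h z)"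
      by (simp add: h_def)
    then have "\<nu> g = \<nu> (\<lambda>z. (\<Sum>n<K. b n * w z ^ n) + h z)"
      by (rule arg_cong)
    also have "\<dots> = \<nu> (\<lambda>z. \<Sum>n<K. b n * w z ^ n) + \<nu> h"
      by (rule gen_dist_add[OF \<nu>(1) loc_an_sum[OF loc_an_scale[OF pow]] loc_anI[OF zero_less_one hB]])
    also have "\<nu> (\<lambda>z. \<Sum>n<K. b n * w z ^ n) = (\<Sum>n<K. b n * \<nu> (\<lambda>z. w z ^ n))"
      by (rule gen_dist_sum[OF \<nu>(1) pow])
    finally have "(\<Sum>n<K. b n * \<nu> (\<lambda>z. w z ^ n)) - \<nu> g = - \<nu> h"
      by simp
    then show ?thesis
      using \<nu>h by (simp only: vabs_minus power_mult)
  qed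
  then show ?thesis
    unfolding sums_def w_def
    by (rule LIMSEQ_geometric_bound) (use theta_cube(4) in auto)
qed

text \<open>Binomial expansion and linearity. It will express the moments at a nearby
  \<open>z\<close> by those at \<open>a\<close>, with \<open>t = p ^ N * (z - a)\<close>.\<close>

lemma gen_dist_shifted_moment:
  fixes \<sigma> :: "'a set"
  assumes \<nu>: "\<nu> \<in> gen_dist \<sigma>"
    and \<kappa>: "vabs \<kappa> \<le> \<theta> ^ 3" and u: "\<And>z. z \<in> disc_nbhd \<sigma> 1 \<Longrightarrow> vabs (u + \<kappa> * z) \<le> \<theta> ^ 3"
  shows "\<nu> (\<lambda>z. (u + t + \<kappa> * z) ^ n)
    = (\<Sum>k\<le>n. of_nat (n choose k) * \<nu> (\<lambda>z. (u + \<kappa> * z) ^ (n - k)) * t ^ k)"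
proof -
  have "(\<lambda>z. (u + t + \<kappa> * z) ^ n)
      = (\<lambda>z. \<Sum>k\<le>n. (of_nat (n choose k) * t ^ k) * (u + \<kappa> * z) ^ (n - k))"
  proof
    fix z
    show "(u + t + \<kappa> * z) ^ n = (\<Sum>k\<le>n. (of_nat (n choose k) * t ^ k) * (u + \<kappa> * z) ^ (n - k))"
      using binomial_ring[of t "u + \<kappa> * z" n] by (simp add: add_ac)
  qed
  then show ?thesis
    using gen_dist_sum[OF \<nu>, of "{..n}" "\<lambda>k z. (u + \<kappa> * z) ^ (n - k)" "\<lambda>k. of_nat (n choose k) * t ^ k"]
      loc_anI[OF zero_less_one affine_power_in_B_space[OF \<kappa> u]]
    by (simp add: mult_ac)
qed

section \<open>The zeta function\<close>

text \<open>The base of the power is \<open>p ^ N * (l + x) - 1\<close>, multiplied out to match the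
  affine form \<open>u + \<kappa> * x\<close> of the lemmas above.\<close>

definition zeta_moment :: "nat \<Rightarrow> (('a \<Rightarrow> 'a) \<Rightarrow> 'a) \<Rightarrow> 'a \<Rightarrow> nat \<Rightarrow> 'a" where
  "zeta_moment N \<nu> l n = \<nu> (\<lambda>x. (of_nat p ^ N * l - 1 + of_nat p ^ N * x) ^ n)"

lemma zeta_integrand_sums:
  assumes P: "fractional_powers p P" and s: "vabs (s::'a) \<le> 1"
    and "vabs (of_nat p ^ N * l - 1 + of_nat p ^ N * x) \<le> \<theta> ^ 3"
  shows "(\<lambda>n. ((1 - s) gchoose n) * (of_nat p ^ N * l - 1 + of_nat p ^ N * x) ^ n)
           sums zeta_integrand p P s l x"
proof -
  have eq: "of_nat p ^ N * l - 1 + of_nat p ^ N * x = of_nat p ^ N * (l + x) - 1"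
    by (simp add: algebra_simps)
  have "vabs (1 - s) \<le> 1"
    using s by (intro vabs_diff_le) auto
  then show ?thesis
    using angle_pow_sums[OF P, of N "l + x" "1 - s"] assms(3)
    unfolding eq zeta_integrand_def by simp
qed

text \<open>Near \<open>\<sigma>\<close> the integrand is a binomial series in an affine form of
  size at most \<open>\<theta> ^ 3\<close>. A zero of \<open>l + x\<close> would give that form the
  value -1, of absolute value 1.\<close>

lemma zeta_well_definedI:
  assumes P: "fractional_powers p P" and s: "vabs (s::'a) \<le> 1" and N: "3 \<le> N"
    and l: "\<And>x. x \<in> disc_nbhd \<sigma> 1 \<Longrightarrow> vabs (of_nat p ^ N * l - 1 + of_nat p ^ N * x) \<le> \<theta> ^ 3"
  shows "zeta_well_defined p P \<sigma> s l"
  unfolding zeta_well_defined_def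
proof (intro exI[of _ 1] conjI ballI)
  have "vabs (of_nat p ^ N :: 'a) \<le> \<theta> ^ 3"
    using power_decreasing[OF N, of \<theta>] theta_gt_0 theta_lt_1 by (simp add: vabs_power vabs_p)
  moreover have "vabs (1 - s) \<le> 1"
    using s by (intro vabs_diff_le) auto
  ultimately show "zeta_integrand p P s l \<in> B_space \<sigma> 1"
    using l vabs_gbinomial_le zeta_integrand_sums[OF P s l]
    by (intro affine_series_in_B_space[where b = "\<lambda>n. (1 - s) gchoose n"]) auto
next
  fix x assume x: "x \<in> disc_nbhd \<sigma> 1"
  show "l + x \<noteq> 0"
  proof
    assume lx: "l + x = 0"
    have "of_nat p ^ N * l - 1 + of_nat p ^ N * x = of_nat p ^ N * (l + x) - 1"
      by (simp add: algebra_simps)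
    then have "vabs (of_nat p ^ N * l - 1 + of_nat p ^ N * x) = 1"
      by (simp only: lx) simp
    then show False
      using l[OF x] theta_cube(2) theta_lt_1 by linarith
  qed
qed simp

text \<open>This series separates the variables: \<open>s\<close> occurs only in the binomial
  coefficients, \<open>l\<close> only in the moments. Both regularity statements start from
  it.\<close>

lemma zeta_E_sums:
  assumes P: "fractional_powers p P" and \<nu>: "\<nu> \<in> gen_dist \<sigma>" "\<sigma> \<noteq> {}"
    and s: "vabs (s::'a) \<le> 1" and N: "3 \<le> N"
    and l: "\<And>x. x \<in> disc_nbhd \<sigma> 1 \<Longrightarrow> vabs (of_nat p ^ N * l - 1 + of_nat p ^ N * x) \<le> \<theta> ^ 3"
  shows "(\<lambda>n. ((1 - s) gchoose n) * zeta_moment N \<nu> l n) sums zeta_E p P \<nu> s l"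
  unfolding zeta_moment_def zeta_E_def
proof (rule gen_dist_affine_series[OF \<nu> _ l])
  show "vabs (of_nat p ^ N :: 'a) \<le> \<theta> ^ 3"
    using power_decreasing[OF N, of \<theta>] theta_gt_0 theta_lt_1 by (simp add: vabs_power vabs_p)
  have "vabs (1 - s) \<le> 1"
    using s by (intro vabs_diff_le) auto
  then show "vabs ((1 - s) gchoose n) \<le> real p ^ n" for n
    by (rule vabs_gbinomial_le)
qed (simp_all add: zeta_integrand_sums[OF P s l])

text \<open>The factor \<open>p\<^sup>-\<^sup>3\<^sup>n\<close> from the moments absorbs the denominators \<open>n!\<close> of the binomial
  coefficients, so that also the divided differences converge uniformly.\<close>

lemma C_infinity_zeta_E:
  assumes P: "fractional_powers p P" and \<nu>: "\<nu> \<in> gen_dist \<sigma>" "(\<sigma> :: 'a set) \<noteq> {}" and N: "3 \<le> N"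
    and l: "\<And>x. x \<in> disc_nbhd \<sigma> 1 \<Longrightarrow> vabs (of_nat p ^ N * l - 1 + of_nat p ^ N * x) \<le> \<theta> ^ 3"
  shows "C_infinity_Zp (\<lambda>s. zeta_E p P \<nu> s l)"
proof -
  have "vabs (of_nat p ^ N :: 'a) \<le> \<theta> ^ 3"
    using power_decreasing[OF N, of \<theta>] theta_gt_0 theta_lt_1 by (simp add: vabs_power vabs_p)
  from gen_dist_moment_bound[OF \<nu> this l] obtain C where
    "\<forall>n. vabs (\<nu> (\<lambda>x. (of_nat p ^ N * l - 1 + of_nat p ^ N * x) ^ n)) \<le> C * (\<theta> ^ 3) ^ n" ..
  then have C: "vabs (zeta_moment N \<nu> l n) \<le> C * (\<theta> ^ 3) ^ n" for n
    by (simp add: zeta_moment_def)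
  have "vabs (zeta_moment N \<nu> l n / fact n) \<le> C * (\<theta> ^ 2) ^ n" for n
  proof -
    have "vabs (zeta_moment N \<nu> l n / fact n) \<le> (C * (\<theta> ^ 3) ^ n) / \<theta> ^ n"
      unfolding vabs_divide
      by (rule frac_le[OF _ C _ vabs_fact_ge]) (use C[of n] theta_gt_0 in \<open>auto intro: order_trans[OF vabs_nonneg]\<close>)
    also have "\<dots> = C * (real p * \<theta> ^ 3) ^ n"
      unfolding power_mult_distrib by (simp add: power_divide)
    finally show ?thesis
      by (simp only: theta_cube(3))
  qed
  then show ?thesis
  proof (rule C_infinity_falling_series)
    fix s :: 'a assume "s \<in> Zp"
    from zeta_E_sums[OF P \<nu> vabs_le_1_if_Zp[OF this] N l]
    show "(\<lambda>n. zeta_moment N \<nu> l n / fact n * (\<Prod>i<n. 1 - s - of_nat i)) sums zeta_E p P \<nu> s l"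
      by (simp add: gbinomial_prod_rev atLeast0LessThan mult_ac)
  qed (use theta_cube in auto)
qed

text \<open>The moments at \<open>z\<close> are expanded in those at \<open>a\<close> by
  \<open>gen_dist_shifted_moment\<close>, and \<open>sums_binomial_rearrange\<close> collects the
  powers of \<open>t = \<kappa> * (z - a)\<close>. On the unit ball around \<open>a\<close> this
  \<open>t\<close> stays within \<open>\<theta> ^ 3\<close>.\<close>

lemma zeta_E_power_series:
  assumes P: "fractional_powers p P" and \<nu>: "\<nu> \<in> gen_dist \<sigma>" "\<sigma> \<noteq> {}"
    and s: "vabs (s::'a) \<le> 1" and N: "3 \<le> N"
    and l: "\<And>l x. l \<in> ball a 1 \<Longrightarrow> x \<in> disc_nbhd \<sigma> 1 \<Longrightarrow>
              vabs (of_nat p ^ N * l - 1 + of_nat p ^ N * x) \<le> \<theta> ^ 3"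
  shows "\<exists>c. \<forall>z\<in>ball a 1. (\<lambda>n. c n * (z - a) ^ n) sums zeta_E p P \<nu> s z"
proof -
  define \<kappa> :: 'a where "\<kappa> = of_nat p ^ N"
  have \<kappa>: "vabs \<kappa> \<le> \<theta> ^ 3"
    using power_decreasing[OF N, of \<theta>] theta_gt_0 theta_lt_1 by (simp add: \<kappa>_def vabs_power vabs_p)
  have a: "vabs (\<kappa> * a - 1 + \<kappa> * x) \<le> \<theta> ^ 3" if "x \<in> disc_nbhd \<sigma> 1" for x
    unfolding \<kappa>_def using that by (intro l) auto
  from gen_dist_moment_bound[OF \<nu> \<kappa> a] obtain C where
    "\<forall>n. vabs (\<nu> (\<lambda>x. (\<kappa> * a - 1 + \<kappa> * x) ^ n)) \<le> C * (\<theta> ^ 3) ^ n" ..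
  then have C: "vabs (zeta_moment N \<nu> a n) \<le> C * (\<theta> ^ 3) ^ n" for n
    by (simp add: zeta_moment_def \<kappa>_def)
  have "vabs (1 - s) \<le> 1"
    using s by (intro vabs_diff_le) auto
  then have b: "vabs ((1 - s) gchoose n) \<le> 1 * real p ^ n" for n
    using vabs_gbinomial_le by simp
  have p\<theta>: "real p * \<theta> ^ 3 < 1"
    using theta_cube by simp
  obtain c where c: "\<And>t S. vabs t \<le> \<theta> ^ 3 \<Longrightarrow>
      (\<lambda>n. ((1 - s) gchoose n) * (\<Sum>k\<le>n. of_nat (n choose k) * zeta_moment N \<nu> a (n - k) * t ^ k)) sums S
      \<Longrightarrow> (\<lambda>k. c k * t ^ k) sums S"
    by (rule sums_binomial_rearrange[OF theta_cube(1) _ p\<theta> b C]) auto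
  have "(\<lambda>n. (c n * \<kappa> ^ n) * (z - a) ^ n) sums zeta_E p P \<nu> s z" if z: "z \<in> ball a 1" for z
  proof -
    define t where "t = \<kappa> * (z - a)"
    have "vabs (z - a) \<le> 1"
      using z by (simp add: dist_commute flip: dist_vabs)
    then have "vabs t \<le> \<theta> ^ 3 * 1"
      unfolding t_def using \<kappa> by (intro vabs_mult_le)
    moreover have "\<kappa> * z - 1 = \<kappa> * a - 1 + t"
      by (simp add: t_def algebra_simps)
    then have "zeta_moment N \<nu> z n
        = (\<Sum>k\<le>n. of_nat (n choose k) * zeta_moment N \<nu> a (n - k) * t ^ k)" for n
      using gen_dist_shifted_moment[OF \<nu>(1) \<kappa> a, of t n]
      by (simp only: zeta_moment_def flip: \<kappa>_def)
    with zeta_E_sums[OF P \<nu> s N l[OF z]]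
    have "(\<lambda>n. ((1 - s) gchoose n) *
        (\<Sum>k\<le>n. of_nat (n choose k) * zeta_moment N \<nu> a (n - k) * t ^ k)) sums zeta_E p P \<nu> s z"
      by simp
    ultimately have "(\<lambda>k. c k * t ^ k) sums zeta_E p P \<nu> s z"
      by (intro c) auto
    then show ?thesis
      by (simp add: t_def power_mult_distrib mult_ac)
  qed
  then show ?thesis
    by (intro exI[of _ "\<lambda>n. c n * \<kappa> ^ n"]) blast
qed

end

theorem theorem3p12:
  fixes p :: nat
    and P :: "rat \<Rightarrow> 'a::{field_char_0, complete_space}"
    and \<sigma> :: "'a set"
    and f :: "'a \<Rightarrow> 'a"
    and \<nu> :: "('a \<Rightarrow> 'a) \<Rightarrow> 'a"
  assumes "prime p" and "odd p"
    and "is_Cp TYPE('a) p"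
    and "fractional_powers p P"
    and "compact \<sigma>"
    and "continuous_on Zp f" and "f ` Zp \<subseteq> \<sigma>"
    and "fermionic_spectral_distribution p \<sigma> f \<nu>"
  shows "\<exists>\<Omega> :: 'a set. open \<Omega> \<and> \<Omega> \<noteq> {} \<and>
           (\<forall>l\<in>\<Omega>. \<forall>s\<in>Zp. zeta_well_defined p P \<sigma> s l) \<and>
           (\<forall>l\<in>\<Omega>. C_infinity_Zp (\<lambda>s. zeta_E p P \<nu> s l)) \<and>
           (\<forall>s\<in>Zp. locally_analytic_on \<Omega> (\<lambda>l. zeta_E p P \<nu> s l))"
proof -
  interpret padic_field "TYPE('a)" p
    using assms(1,3) by unfold_locales (auto simp: is_Cp_def)
  have \<nu>: "\<nu> \<in> gen_dist \<sigma>"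
    using assms(8) by (simp add: fermionic_spectral_distribution_def)
  \<comment> \<open>The value of \<open>f\<close> at 0 makes \<open>\<sigma>\<close>
    nonempty.\<close>
  have "(0 :: 'a) \<in> Zp"
    unfolding Zp_def using closure_subset by fastforce
  then have \<sigma>: "\<sigma> \<noteq> {}"
    using assms(7) by auto
  obtain R0 where R0: "\<And>x. x \<in> \<sigma> \<Longrightarrow> vabs x \<le> R0"
    using compact_imp_bounded[OF assms(5)] unfolding bounded_any_center[of _ 0]
    by (auto simp: dist_commute vabs_def)
  \<comment> \<open>The lower bound 1 makes \<open>R\<close> positive, absorbs the unit thickening
    of \<open>\<sigma>\<close> and keeps \<open>\<theta> ^ 3 / R\<close> at most
    \<open>\<theta> ^ 3\<close>.\<close>
  define R where "R = max R0 1"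
  have R: "vabs x \<le> R" if x: "x \<in> disc_nbhd \<sigma> 1" for x
  proof -
    obtain a where a: "a \<in> \<sigma>" "dist a x < 1"
      using x by (auto simp: disc_nbhd_def)
    then show ?thesis
      using vabs_diff_le[of a R "a - x"] R0[of a] by (auto simp: R_def dist_vabs)
  qed
  \<comment> \<open>\<open>N\<close> is so large that \<open>p ^ N * x\<close> stays within
    \<open>\<theta> ^ 3\<close> for \<open>x\<close> near \<open>\<sigma>\<close>; as
    \<open>R\<close> is at least 1, this also forces \<open>3 \<le> N\<close>.\<close>
  obtain N where N: "\<theta> ^ N < \<theta> ^ 3 / R"
    using real_arch_pow_inv[OF _ theta_lt_1, of "\<theta> ^ 3 / R"] theta_cube(1) by (auto simp: R_def)
  have "\<theta> ^ 3 / R \<le> \<theta> ^ 3 / 1"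
    using theta_cube(1) by (intro divide_left_mono) (auto simp: R_def)
  then have "\<theta> ^ N < \<theta> ^ 3"
    using N by linarith
  then have N3: "3 \<le> N"
    using power_decreasing[of N 3 \<theta>] theta_gt_0 theta_lt_1 by (intro leI notI) auto
  define \<kappa> :: 'a where "\<kappa> = of_nat p ^ N"
  have v\<kappa>: "vabs \<kappa> = \<theta> ^ N"
    by (simp add: \<kappa>_def vabs_power vabs_p)
  \<comment> \<open>A closed ball around \<open>1 / \<kappa>\<close>, which is also open because the
    metric is ultrametric.\<close>
  define \<Omega> where "\<Omega> = {l. vabs (\<kappa> * l - 1) \<le> \<theta> ^ 3}"
  \<comment> \<open>\<open>\<kappa>\<close> is smaller than \<open>\<theta> ^ 3\<close>, so moving
    \<open>a\<close> by less than 1 stays inside. This gives openness and the uniform radius 1 for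
    the expansions in \<open>l\<close>.\<close>
  have ball: "z \<in> \<Omega>" if a: "a \<in> \<Omega>" and z: "z \<in> ball a 1" for a z
  proof -
    have "vabs (z - a) \<le> 1"
      using z by (simp add: dist_commute flip: dist_vabs)
    then have "vabs (\<kappa> * (z - a)) \<le> \<theta> ^ 3 * 1"
      using \<open>\<theta> ^ N < \<theta> ^ 3\<close> v\<kappa> by (intro vabs_mult_le) auto
    then have "vabs ((\<kappa> * a - 1) + \<kappa> * (z - a)) \<le> \<theta> ^ 3"
      using a by (intro vabs_add_le) (auto simp: \<Omega>_def)
    then show ?thesis
      by (simp add: \<Omega>_def algebra_simps)
  qed
  have l: "vabs (of_nat p ^ N * l - 1 + of_nat p ^ N * x) \<le> \<theta> ^ 3" if "l \<in> \<Omega>" "x \<in> disc_nbhd \<sigma> 1" for l x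
  proof -
    have "vabs (\<kappa> * x) \<le> \<theta> ^ N * R"
      using R[OF that(2)] v\<kappa> by (intro vabs_mult_le) auto
    also have "\<dots> \<le> \<theta> ^ 3"
      using N by (auto simp: R_def pos_less_divide_eq intro: less_imp_le)
    finally show ?thesis
      using that(1) by (intro vabs_add_le) (auto simp: \<Omega>_def \<kappa>_def)
  qed
  have "open \<Omega>"
    unfolding open_contains_ball using ball by (meson subsetI zero_less_one)
  moreover have "1 / \<kappa> \<in> \<Omega>"
    using p_nonzero by (simp add: \<Omega>_def \<kappa>_def)
  then have "\<Omega> \<noteq> {}"
    by blast
  moreover have "\<forall>l\<in>\<Omega>. \<forall>s\<in>Zp. zeta_well_defined p P \<sigma> s l"
    using zeta_well_definedI[OF assms(4) vabs_le_1_if_Zp N3 l] by blast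
  moreover have "\<forall>l\<in>\<Omega>. C_infinity_Zp (\<lambda>s. zeta_E p P \<nu> s l)"
    using C_infinity_zeta_E[OF assms(4) \<nu> \<sigma> N3 l] by blast
  moreover have "locally_analytic_on \<Omega> (\<lambda>l. zeta_E p P \<nu> s l)" if s: "s \<in> Zp" for s
    unfolding locally_analytic_on_def
  proof
    fix a assume a: "a \<in> \<Omega>"
    from zeta_E_power_series[OF assms(4) \<nu> \<sigma> vabs_le_1_if_Zp[OF s] N3 l[OF ball[OF a]]]
    obtain c where "\<forall>z\<in>ball a 1. (\<lambda>n. c n * (z - a) ^ n) sums zeta_E p P \<nu> s z" ..
    then show "\<exists>r>0. \<exists>c. ball a r \<subseteq> \<Omega> \<and> (\<forall>z\<in>ball a r. (\<lambda>n. c n * (z - a) ^ n) sums zeta_E p P \<nu> s z)"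
      using ball[OF a] by (intro exI[of _ 1] conjI exI[of _ c]) auto
  qed
  ultimately show ?thesis
    by blast
qed

end
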